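(* Let $n = p_1^{r_1} p_2^{r_2} \cdots p_s^{r_s}$ where $p_1 < p_2 < \cdots < p_s$ are primes (with $s\ge 1$ and all $r_i\ge 1$). Let $X$ be a circulant graph (respectively, circulant multigraph) of order $n$ whose connection set (respectively, connection multiset) has size $m$. If $p_1 \geq m$ and either $s = 1$ or $p_2 > p_1 (m-1)$, then any circulant graph (respectively, circulant multigraph) isospectral to $X$ must be isomorphic to $X$.
   Context: A circulant graph of order $n$ is a (directed) Cayley graph $\mathrm{Cay}(\mathbb{Z}_n, S)$ of the cyclic group $\mathbb{Z}_n$: its vertices are the elements of $\mathbb{Z}_n$ and there is an arc from $x$ to $x+s$ for each $x\in\mathbb{Z}_n$ and $s\in S$, where the connection set $S$ is a subset of $\mathbb{Z}_n\setminus\{0\}$ (not required to satisfy $S=-S$). If instead $S$ is a multiset of elements of $\mathbb{Z}_n$ (arcs are then counted with multiplicity), $\mathrm{Cay}(\mathbb{Z}_n,S)$ is called a circulant multigraph with connection multiset $S$; the size of a multiset counts multiplicity. The spectrum of a graph is the list (multiset) of eigenvalues of its adjacency matrix; two graphs are isospectral if their spectra are the same. *)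

theory Defs
  imports
    "HOL-Algebra.Elementary_Groups"
    "Graph_Theory.Graph_Theory"
    "Jordan_Normal_Form.Char_Poly"
    "HOL-Computational_Algebra.Fundamental_Theorem_Algebra"
begin

definition cayley_digraph ::
  "('a, 'm) monoid_scheme \<Rightarrow> 'a set \<Rightarrow> ('a, 'a \<times> 'a) pre_digraph" where
  "cayley_digraph G S = with_proj
     \<lparr> pverts = carrier G, parcs = {(x, x \<otimes>\<^bsub>G\<^esub> s) | x s. x \<in> carrier G \<and> s \<in> S} \<rparr>"

text \<open>The arc \<open>(x, s, i)\<close> is the \<open>i\<close>-th parallel copy of the arc from \<open>x\<close> to \<open>x s\<close>;
  the copies are indexed by \<open>i < count S s\<close>.\<close>

definition cayley_multidigraph ::
  "('a, 'm) monoid_scheme \<Rightarrow> 'a multiset \<Rightarrow> ('a, 'a \<times> 'a \<times> nat) pre_digraph" where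
  "cayley_multidigraph G S =
     \<lparr> verts = carrier G,
       arcs = {(x, s, i). x \<in> carrier G \<and> i < count S s},
       tail = (\<lambda>(x, s, i). x),
       head = (\<lambda>(x, s, i). x \<otimes>\<^bsub>G\<^esub> s) \<rparr>"

abbreviation circulant_graph :: "nat \<Rightarrow> int set \<Rightarrow> (int, int \<times> int) pre_digraph" where
  "circulant_graph n S \<equiv> cayley_digraph (integer_mod_group n) S"

abbreviation circulant_multigraph ::
  "nat \<Rightarrow> int multiset \<Rightarrow> (int, int \<times> int \<times> nat) pre_digraph" where
  "circulant_multigraph n S \<equiv> cayley_multidigraph (integer_mod_group n) S"

text \<open>Rows and columns follow the increasing enumeration of the vertices; any other
  enumeration gives a permutation-similar matrix. Entries count arcs with multiplicity.\<close>

definition adjacency_matrix :: "('a :: linorder, 'b) pre_digraph \<Rightarrow> complex mat" where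
  "adjacency_matrix G =
     (let vs = sorted_list_of_set (verts G) in
      mat (length vs) (length vs)
        (\<lambda>(i, j). of_nat (card {e \<in> arcs G. tail G e = vs ! i \<and> head G e = vs ! j})))"

text \<open>The eigenvalues counted with algebraic multiplicity.\<close>

definition digraph_spectrum :: "('a :: linorder, 'b) pre_digraph \<Rightarrow> complex multiset" where
  "digraph_spectrum G = proots (char_poly (adjacency_matrix G))"

definition isospectral ::
  "('a :: linorder, 'b) pre_digraph \<Rightarrow> ('c :: linorder, 'd) pre_digraph \<Rightarrow> bool" where
  "isospectral G H \<longleftrightarrow> digraph_spectrum G = digraph_spectrum H"

end

theory Submission
  imports Defs "HOL-Number_Theory.Cong"
begin

text \<open>Write \<open>\<zeta>\<close> for a primitive \<open>n\<close>-th root of unity. The eigenvalues of \<open>Cay(Z\<^sub>n, S)\<close> are the character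
sums \<open>\<Lambda>\<^sub>j(S) = \<Sum>\<^bsub>s\<in>S\<^esub> \<zeta>\<^bsup>js\<^esup>\<close>, because a circulant matrix has the characters of \<open>Z\<^sub>n\<close> as eigenvectors
(\<open>circulant_mat_eigenvalue_iff\<close>). An isospectral \<open>T\<close> has the same order and size, and there is a \<open>j\<close>
with \<open>\<Lambda>\<^sub>1(S) = \<Lambda>\<^sub>j(T) = \<Lambda>\<^sub>1(jT)\<close>: two multisets of \<open>m\<close> roots of unity with the same sum. Likewise
\<open>\<Lambda>\<^sub>1(T) = \<Lambda>\<^sub>1(lS)\<close> for some \<open>l\<close>.

The hypothesis on the primes makes such a coincidence rigid. Suppose \<open>\<Sum> c\<^sub>a \<zeta>\<^bsup>a\<^esup> = 0\<close> with integers \<open>c\<^sub>a\<close>,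
and let \<open>q\<close> be a prime divisor of \<open>n\<close>. Comparing the relation with its Galois conjugates under
\<open>\<zeta> \<mapsto> \<zeta>\<^bsup>1+(n/q)i\<^esup>\<close> shows that the parts of the sum over the residue classes modulo \<open>q\<close> all vanish, as
soon as \<open>q\<^sup>2\<close> divides \<open>n\<close> or one class carries no term (\<open>class_sums_vanish\<close>). If \<open>q\<close> exceeds the number
of terms, one class is free of terms by the pigeonhole principle. Splitting repeatedly until
only one prime \<open>p\<close> is left shows that \<open>c\<close> has period \<open>n/p\<close> (\<open>vanishing_sum_periodic\<close>). For the
difference of two multisets of size \<open>m \<le> p\<close>, with \<open>p\<close> the least prime divisor, this leaves only two
possibilities: the multisets are equal, or \<open>m = p\<close> and both are cosets of the subgroup of order
\<open>p\<close>, whose sums are zero (\<open>equal_char_sums_dichotomy\<close>).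

If \<open>S = jT\<close> and \<open>T = lS\<close>, then neither multiplication changes the orders of the elements
involved, so multiplication by \<open>j\<close> agrees on \<open>T\<close> with multiplication by a unit
(\<open>mutual_dilations_imp_unit\<close>). If one of \<open>S\<close>, \<open>T\<close> is a coset, so is the other, and the eigenvalues
\<open>\<Lambda>\<^sub>p\<close> reduce the question to two one-element multisets in \<open>Z\<^bsub>n/p\<^esub>\<close>
(\<open>cosets_same_spectrum_imp_unit\<close>). In all cases \<open>S = uT\<close> for a unit \<open>u\<close> of \<open>Z\<^sub>n\<close>, and \<open>x \<mapsto> ux\<close> is an
isomorphism of the graphs.

The arithmetic input is the transitivity of the Galois action: if an integer polynomial
vanishes at a root of unity \<open>\<zeta>\<close> of order dividing \<open>n\<close>, it vanishes at \<open>\<zeta>\<^bsup>k\<^esup>\<close> for all \<open>k\<close> prime to \<open>n\<close>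
(\<open>galois_conjugate_root\<close>). It is proved after Landau, with Frobenius congruences modulo large
primes.\<close>

section \<open>Circulant matrices\<close>

definition circulant_mat :: "nat \<Rightarrow> (nat \<Rightarrow> 'a) \<Rightarrow> 'a mat" where
  "circulant_mat n c = mat n n (\<lambda>(i, j). c ((j + n - i) mod n))"

lemma circulant_mat_carrier [simp]: "circulant_mat n c \<in> carrier_mat n n"
  by (simp add: circulant_mat_def)

lemma bij_betw_add_mod:
  fixes n i :: nat
  assumes "i \<le> n"
  shows "bij_betw (\<lambda>d. (d + i) mod n) {..<n} {..<n}"
    and "\<And>d. d < n \<Longrightarrow> ((d + i) mod n + n - i) mod n = d"
proof -
  show *: "((d + i) mod n + n - i) mod n = d" if "d < n" for d
  proof (cases "d + i < n")
    case True
    then show ?thesis using that assms by simp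
  next
    case False
    then have "(d + i) mod n = d + i - n" using that assms
      by (cases "d + i = 2 * n") (auto simp: mod_if)
    then show ?thesis using that False by simp
  qed
  have "inj_on (\<lambda>d. (d + i) mod n) {..<n}"
    by (rule inj_on_inverseI[where g = "\<lambda>d. (d + n - i) mod n"]) (use * in auto)
  moreover have "(\<lambda>d. (d + i) mod n) ` {..<n} \<subseteq> {..<n}"
    by (auto intro: mod_less_divisor)
  ultimately show "bij_betw (\<lambda>d. (d + i) mod n) {..<n} {..<n}"
    by (simp add: bij_betw_def endo_inj_surj)
qed

lemma power_mod_root_of_unity:
  fixes z :: "'a :: monoid_mult"
  assumes "z ^ n = 1"
  shows "z ^ (k mod n) = z ^ k"
proof -
  have "z ^ k = z ^ (n * (k div n) + k mod n)" by simp
  also have "\<dots> = z ^ (k mod n)" unfolding power_add power_mult assms by simp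
  finally show ?thesis by simp
qed

text \<open>The geometric vector of an \<open>n\<close>-th root of unity \<open>z\<close> is an eigenvector: shifting the index by \<open>d\<close>
multiplies it by \<open>z ^ d\<close>.\<close>

lemma circulant_mat_mult_vec:
  fixes z :: "'a :: field"
  assumes "z ^ n = 1"
  shows "circulant_mat n c *\<^sub>v vec n (\<lambda>j. z ^ j) = (\<Sum>d<n. c d * z ^ d) \<cdot>\<^sub>v vec n (\<lambda>j. z ^ j)"
proof (rule eq_vecI)
  fix i assume "i < dim_vec ((\<Sum>d<n. c d * z ^ d) \<cdot>\<^sub>v vec n (\<lambda>j. z ^ j))"
  then have i: "i < n" by simp
  note zmod = power_mod_root_of_unity[OF assms]
  have "(circulant_mat n c *\<^sub>v vec n (\<lambda>j. z ^ j)) $ i = (\<Sum>j<n. c ((j + n - i) mod n) * z ^ j)"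
    using i by (simp add: circulant_mat_def mult_mat_vec_def scalar_prod_def atLeast0LessThan)
  also have "\<dots> = (\<Sum>d<n. c (((d + i) mod n + n - i) mod n) * z ^ ((d + i) mod n))"
    using bij_betw_add_mod(1)[of i n] i
    by (intro sum.reindex_bij_betw[symmetric]) auto
  also have "\<dots> = (\<Sum>d<n. c d * z ^ d * z ^ i)"
    using i by (intro sum.cong) (auto simp: bij_betw_add_mod(2) zmod power_add)
  finally show "(circulant_mat n c *\<^sub>v vec n (\<lambda>j. z ^ j)) $ i =
      ((\<Sum>d<n. c d * z ^ d) \<cdot>\<^sub>v vec n (\<lambda>j. z ^ j)) $ i"
    using i by (simp add: sum_distrib_right)
qed (simp add: circulant_mat_def)

lemma circulant_mat_eigenvalue:
  fixes z :: "'a :: field"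
  assumes "z ^ n = 1" "n > 0"
  shows "eigenvalue (circulant_mat n c) (\<Sum>d<n. c d * z ^ d)"
proof -
  have "vec n (\<lambda>j. z ^ j) \<noteq> 0\<^sub>v n"
  proof
    assume "vec n (\<lambda>j. z ^ j) = 0\<^sub>v n"
    then have "vec n (\<lambda>j. z ^ j) $ 0 = 0\<^sub>v n $ 0" by simp
    then show False using assms by simp
  qed
  then show ?thesis
    unfolding eigenvalue_def eigenvector_def
    using circulant_mat_mult_vec[OF assms(1)]
    by (intro exI[of _ "vec n (\<lambda>j. z ^ j)"]) (simp add: circulant_mat_def)
qed

section \<open>Galois conjugates of roots of unity\<close>

text \<open>The binomial coefficients other than the two outer ones are divisible by \<open>q\<close>. This is a version of
\<open>freshmans_dream\<close> for rings of any characteristic.\<close>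

lemma prime_dvd_power_add:
  fixes x y :: "'a :: comm_ring_1"
  assumes "prime q"
  shows "of_nat q dvd (x + y) ^ q - (x ^ q + y ^ q)"
proof -
  have q: "q > 0" using assms prime_gt_0_nat by blast
  have "(x + y) ^ q = (\<Sum>k\<le>q. of_nat (q choose k) * x ^ k * y ^ (q - k))"
    by (rule binomial_ring)
  also have "{..q} = insert 0 (insert q {0<..<q})"
    using q by auto
  also have "(\<Sum>k\<in>\<dots>. of_nat (q choose k) * x ^ k * y ^ (q - k))
      = y ^ q + x ^ q + (\<Sum>k\<in>{0<..<q}. of_nat (q choose k) * x ^ k * y ^ (q - k))"
    using q by simp
  finally have *: "(x + y) ^ q - (x ^ q + y ^ q)
      = (\<Sum>k\<in>{0<..<q}. of_nat (q choose k) * x ^ k * y ^ (q - k))"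
    by simp
  have "of_nat q dvd (of_nat (q choose k) * x ^ k * y ^ (q - k) :: 'a)" if "k \<in> {0<..<q}" for k
  proof -
    have "q dvd (q choose k)"
      by (rule dvd_choose_prime) (use that assms in auto)
    then show ?thesis by (metis dvd_mult2 of_nat_mult dvd_def mult.assoc)
  qed
  then show ?thesis unfolding * by (intro dvd_sum) auto
qed

lemma prime_dvd_power_diff_int:
  fixes c :: int
  assumes "prime q"
  shows "int q dvd c ^ q - c"
proof -
  have q: "q > 0" using assms prime_gt_0_nat by blast
  have step: "int q dvd (c + 1) ^ q - (c + 1) \<longleftrightarrow> int q dvd c ^ q - c" for c :: int
  proof -
    have "int q dvd (c + 1) ^ q - (c ^ q + 1)"
      using prime_dvd_power_add[OF assms, of c 1] by simp
    then have "int q dvd ((c + 1) ^ q - (c ^ q + 1)) + (c ^ q - c) \<longleftrightarrow> int q dvd c ^ q - c"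
      by (rule dvd_add_right_iff)
    moreover have "((c + 1) ^ q - (c ^ q + 1)) + (c ^ q - c) = (c + 1) ^ q - (c + 1)"
      by simp
    ultimately show ?thesis by (simp only:)
  qed
  show ?thesis
  proof (induction c rule: int_induct[where k = 0])
    case base
    then show ?case using q by (simp add: power_0_left)
  next
    case (step1 i)
    then show ?case using step by blast
  next
    case (step2 i)
    then show ?case using step[of "i - 1"] by simp
  qed
qed

text \<open>Additivity of the \<open>q\<close>-th power modulo \<open>q\<close>, together with Fermat's little theorem for the
coefficients, lets the Frobenius map act on the indeterminate alone.\<close>

lemma frobenius_int_poly:
  fixes F :: "int poly"
  assumes "prime q"
  shows "of_nat q dvd F ^ q - F \<circ>\<^sub>p Polynomial.monom 1 q"
proof (induction F)
  case 0
  then show ?case using prime_gt_0_nat[OF assms] by (simp add: power_0_left)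
next
  case (pCons c G)
  have eq: "pCons c G = [:c:] + Polynomial.monom 1 1 * G"
    by (simp add: monom_altdef)
  have 1: "of_nat q dvd ([:c:] + Polynomial.monom 1 1 * G) ^ q - ([:c:] ^ q + (Polynomial.monom 1 1 * G) ^ q)"
    by (rule prime_dvd_power_add[OF assms])
  have "[:int q:] dvd [:c ^ q - c:]"
    using prime_dvd_power_diff_int[OF assms, of c] by simp
  then have 2: "of_nat q dvd [:c:] ^ q - [:c:]"
    by (simp add: of_nat_poly poly_const_pow)
  have "of_nat q dvd Polynomial.monom 1 q * (G ^ q - G \<circ>\<^sub>p Polynomial.monom 1 q)"
    using pCons.IH by simp
  then have 3: "of_nat q dvd (Polynomial.monom 1 1 * G) ^ q - Polynomial.monom 1 q * (G \<circ>\<^sub>p Polynomial.monom 1 q)"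
    by (simp add: power_mult_distrib monom_power algebra_simps)
  have X: "Polynomial.monom 1 1 \<circ>\<^sub>p r = r" for r :: "int poly"
    by (simp add: monom_altdef pcompose_pCons)
  have "pCons c G ^ q - pCons c G \<circ>\<^sub>p Polynomial.monom 1 q =
     (([:c:] + Polynomial.monom 1 1 * G) ^ q - ([:c:] ^ q + (Polynomial.monom 1 1 * G) ^ q))
     + ([:c:] ^ q - [:c:]) + ((Polynomial.monom 1 1 * G) ^ q - Polynomial.monom 1 q * (G \<circ>\<^sub>p Polynomial.monom 1 q))"
    unfolding eq by (simp add: pcompose_add pcompose_mult X del: One_nat_def)
  then show ?case using 1 2 3 by (simp only: dvd_add)
qed

text \<open>The number is an eigenvalue of an integer circulant matrix, whose characteristic polynomial is
monic with integer coefficients. The coefficients of \<open>h\<close> with congruent exponents are collected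
to obtain the first row of that matrix.\<close>

lemma algebraic_int_poly_root_of_unity:
  fixes z :: complex
  assumes "z ^ n = 1" "n > 0"
  shows "algebraic_int (poly (map_poly of_int h) z)"
proof -
  define c where "c = (\<lambda>d. \<Sum>k | k \<le> Polynomial.degree h \<and> k mod n = d. Polynomial.coeff h k)"
  note zmod = power_mod_root_of_unity[OF assms(1)]
  have "poly (map_poly of_int h) z = (\<Sum>k\<le>Polynomial.degree h. of_int (Polynomial.coeff h k) * z ^ k)"
    by (simp add: poly_altdef degree_map_poly coeff_map_poly)
  also have "\<dots> = (\<Sum>d<n. \<Sum>k | k \<in> {..Polynomial.degree h} \<and> k mod n = d. of_int (Polynomial.coeff h k) * z ^ k)"
    using assms(2) by (intro sum.group[symmetric]) auto
  also have "\<dots> = (\<Sum>d<n. of_int (c d) * z ^ d)"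
    unfolding c_def of_int_sum sum_distrib_right
    by (intro sum.cong refl) (auto simp: zmod)
  finally have eq: "poly (map_poly of_int h) z = (\<Sum>d<n. of_int (c d) * z ^ d)" .
  let ?A = "circulant_mat n c"
  have map: "circulant_mat n (\<lambda>d. of_int (c d)) = map_mat of_int ?A"
    by (auto simp: circulant_mat_def)
  have "eigenvalue (circulant_mat n (\<lambda>d. of_int (c d))) (\<Sum>d<n. of_int (c d) * z ^ d)"
    by (rule circulant_mat_eigenvalue[OF assms])
  then have "poly (char_poly (map_mat of_int ?A)) (poly (map_poly of_int h) z) = 0"
    unfolding eq map[symmetric]
    by (subst (asm) eigenvalue_root_char_poly[where n = n]) auto
  then have "poly (map_poly of_int (char_poly ?A)) (poly (map_poly of_int h) z) = 0"
    by (simp add: of_int_hom.char_poly_hom[of _ n])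
  moreover have "lead_coeff (char_poly ?A) = 1"
    using degree_monic_char_poly[of ?A n] by simp
  ultimately show ?thesis unfolding algebraic_int_altdef_ipoly by blast
qed

text \<open>A nonzero element \<open>\<alpha>\<close> of \<open>\<int>[z]\<close> is divisible there by only finitely many primes. It divides a nonzero
integer \<open>N\<close>, namely the lowest nonzero coefficient of an integer polynomial with root \<open>\<alpha>\<close>. If \<open>q\<close>
divides \<open>\<alpha>\<close>, then \<open>N / q\<close> is a rational algebraic integer, so \<open>q\<close> divides \<open>N\<close>.\<close>

lemma prime_multiple_bounded:
  fixes z :: complex
  assumes "z ^ n = 1" "n > 0" and nz: "poly (map_poly of_int g) z \<noteq> 0"
  shows "\<exists>N::nat. \<forall>q h. prime q \<longrightarrow> poly (map_poly of_int g) z = of_nat q * poly (map_poly of_int h) z \<longrightarrow> q \<le> N"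
proof -
  let ?e = "\<lambda>h. poly (map_poly of_int h) z"
  obtain P :: "int poly" where P: "poly (map_poly of_int P) (?e g) = 0" "lead_coeff P = 1"
    using algebraic_int_poly_root_of_unity[OF assms(1,2)] unfolding algebraic_int_altdef_ipoly by metis
  then have "P \<noteq> 0" by auto
  then obtain Q where Q: "P = [:- 0, 1:] ^ Polynomial.order 0 P * Q" "\<not> [:- 0, 1:] dvd Q"
    using order_decomp by blast
  have "?e g ^ Polynomial.order 0 P * poly (map_poly of_int Q) (?e g) = 0"
    using P(1) by (subst (asm) Q(1)) (simp add: of_int_poly_hom.hom_mult of_int_poly_hom.hom_power hom_distribs)
  then have Q0: "poly (map_poly of_int Q) (?e g) = 0" using nz by simp
  obtain N R where NR: "Q = pCons N R" by (cases Q) auto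
  have N: "N \<noteq> 0" using Q(2) NR by (simp add: dvd_iff_poly_eq_0)
  have N_eq: "of_int N = - ?e g * ?e (R \<circ>\<^sub>p g)"
  proof -
    have "of_int N + ?e g * poly (map_poly of_int R) (?e g) = (0::complex)"
      using Q0 unfolding NR by (simp add: hom_distribs)
    moreover have "poly (map_poly of_int R) (?e g) = ?e (R \<circ>\<^sub>p g)"
      by (simp add: of_int_hom.map_poly_pcompose poly_pcompose)
    ultimately show ?thesis by (simp add: eq_neg_iff_add_eq_0)
  qed
  show ?thesis
  proof (intro exI[of _ "nat \<bar>N\<bar>"] allI impI)
    fix q h assume q: "prime q" and h: "?e g = of_nat q * ?e h"
    \<comment> \<open>The quotient \<open>N / q\<close>, written as an element of \<open>\<int>[z]\<close>.\<close>
    define b where "b = ?e (- h * (R \<circ>\<^sub>p g))"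
    have b: "of_int N = of_nat q * b"
      unfolding b_def N_eq h by (simp add: hom_distribs)
    have "q \<noteq> 0" using q by auto
    then have "b = of_int N / of_nat q" using b by simp
    then have "b \<in> \<rat>" by simp
    moreover have "algebraic_int b"
      unfolding b_def by (rule algebraic_int_poly_root_of_unity[OF assms(1,2)])
    ultimately have "b \<in> \<int>" by (intro rational_algebraic_int_is_int)
    then obtain k where "b = of_int k" by (auto elim: Ints_cases)
    then have "of_int N = (of_int (int q * k) :: complex)" using b by simp
    then have "N = int q * k" unfolding of_int_eq_iff .
    then have "int q dvd N" by simp
    then show "q \<le> nat \<bar>N\<bar>"
      using N dvd_imp_le_int[of N "int q"] by simp
  qed
qed

text \<open>Add to \<open>k\<close> the product of \<open>L\<close> with those small primes that do not divide \<open>k\<close>: each small prime then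
divides exactly one of the two summands.\<close>

lemma lift_coprime_large_primes:
  fixes k L A :: nat
  assumes "coprime k L" "L > 0"
  shows "\<exists>k'>0. [k' = k] (mod L) \<and> (\<forall>q. prime q \<longrightarrow> q dvd k' \<longrightarrow> A < q)"
proof -
  define t where "t = \<Prod>{q. prime q \<and> q \<le> A \<and> \<not> q dvd k}"
  have fin: "finite {q. prime q \<and> q \<le> A \<and> \<not> q dvd k}" by simp
  have "A < q" if q: "prime q" "q dvd k + L * t" for q
  proof (rule ccontr)
    assume "\<not> A < q"
    then have le: "q \<le> A" by simp
    show False
    proof (cases "q dvd k")
      case True
      then have "q dvd L * t" using q(2) by (simp add: dvd_add_right_iff)
      then have "q dvd L \<or> q dvd t" using q(1) prime_dvd_mult_iff by blast
      moreover have "\<not> q dvd L" using True assms q(1) coprime_common_divisor_nat not_prime_1 by blast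
      moreover have "\<not> q dvd t"
      proof
        assume "q dvd t"
        then obtain r where "prime r" "\<not> r dvd k" "q dvd r"
          unfolding t_def using q(1) fin by (auto simp: prime_dvd_prod_iff)
        then show False using True q(1) primes_dvd_imp_eq by blast
      qed
      ultimately show False by blast
    next
      case False
      then have "q dvd t" unfolding t_def using q(1) le fin by (intro dvd_prodI) auto
      then have "q dvd k" using q(2) by (simp add: dvd_add_left_iff)
      then show False using False by simp
    qed
  qed
  moreover have "[k + L * t = k] (mod L)" by (simp add: cong_def)
  moreover have "k + L * t > 0"
    unfolding t_def using assms(2) by (auto intro!: prod_pos prime_gt_0_nat)
  ultimately show ?thesis by blast
qed

text \<open>Landau's argument. If \<open>F\<close> vanishes at \<open>z\<^sup>j\<close>, then the Frobenius congruence makes \<open>F(z\<^bsup>jq\<^esup>)\<close> a multiple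
of \<open>q\<close> in \<open>\<int>[z]\<close>. There are only finitely many numbers \<open>F(z\<^sup>i)\<close>, so for all sufficiently large primes
\<open>q\<close> this forces \<open>F(z\<^bsup>jq\<^esup>) = 0\<close>. Every exponent prime to \<open>n\<close> is congruent to a product of such primes.\<close>

theorem galois_conjugate_root:
  fixes z :: complex and F :: "int poly"
  assumes z: "z ^ n = 1" "n > 0" and root: "poly (map_poly of_int F) z = 0" and k: "coprime k n"
  shows "poly (map_poly of_int F) (z ^ k) = 0"
proof -
  let ?e = "\<lambda>h x. poly (map_poly of_int h) x :: complex"
  note zmod = power_mod_root_of_unity[OF z(1)]
  have e_pow: "?e h (z ^ j) = ?e (h \<circ>\<^sub>p Polynomial.monom 1 j) z" for h j
    by (simp add: of_int_hom.map_poly_pcompose poly_pcompose poly_monom)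
  have "\<exists>N. \<forall>q h. ?e F (z ^ j) \<noteq> 0 \<longrightarrow> prime q \<longrightarrow> ?e F (z ^ j) = of_nat q * ?e h z \<longrightarrow> q \<le> N" for j
    using prime_multiple_bounded[OF z, of "F \<circ>\<^sub>p Polynomial.monom 1 j"] unfolding e_pow by blast
  then obtain N where N: "?e F (z ^ j) \<noteq> 0 \<Longrightarrow> prime q \<Longrightarrow> ?e F (z ^ j) = of_nat q * ?e h z \<Longrightarrow> q \<le> N j"
    for j :: nat and q :: nat and h by metis
  \<comment> \<open>A common bound for all \<open>j\<close>.\<close>
  define A where "A = (\<Sum>j<n. N j)"
  have step: "?e F (z ^ (j * q)) = 0" if q: "prime q" "A < q" and j: "?e F (z ^ j) = 0" for j q
  proof (rule ccontr)
    assume nz: "?e F (z ^ (j * q)) \<noteq> 0"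
    obtain G where "F ^ q - F \<circ>\<^sub>p Polynomial.monom 1 q = of_nat q * G"
      using frobenius_int_poly[OF q(1), of F] by (auto simp: dvd_def)
    then have "F \<circ>\<^sub>p Polynomial.monom 1 q = F ^ q - of_nat q * G" by (simp add: algebra_simps)
    then have "?e (F \<circ>\<^sub>p Polynomial.monom 1 q) (z ^ j) = ?e (F ^ q - of_nat q * G) (z ^ j)" by simp
    then have "?e F ((z ^ j) ^ q) = ?e F (z ^ j) ^ q - of_nat q * ?e G (z ^ j)"
      by (simp add: of_int_hom.map_poly_pcompose poly_pcompose poly_monom hom_distribs)
    then have "?e F (z ^ (j * q)) = of_nat q * ?e (- G) (z ^ j)"
      using j prime_gt_0_nat[OF q(1)] by (simp add: power_mult hom_distribs)
    then have eq: "?e F (z ^ (j * q)) = of_nat q * ?e ((- G) \<circ>\<^sub>p Polynomial.monom 1 j) z"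
      by (simp only: e_pow)
    let ?r = "(j * q) mod n"
    have "q \<le> N ?r"
      using N[of ?r q] nz eq q(1) by (simp only: zmod)
    also have "\<dots> \<le> A" unfolding A_def using z(2) by (intro member_le_sum) auto
    finally show False using q(2) by simp
  qed
  have prod: "?e F (z ^ (j * l)) = 0"
    if "?e F (z ^ j) = 0" "l > 0" "\<forall>q. prime q \<longrightarrow> q dvd l \<longrightarrow> A < q" for j l
    using that
  proof (induction l arbitrary: j rule: less_induct)
    case (less l)
    show ?case
    proof (cases "l = 1")
      case True
      then show ?thesis using less.prems by simp
    next
      case False
      then obtain q where q: "prime q" "q dvd l" using prime_factor_nat by blast
      then obtain l' where l': "l = q * l'" by auto
      have "l' < l" "l' > 0" using l' q(1) less.prems(2) prime_gt_1_nat by auto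
      then have "?e F (z ^ (j * q * l')) = 0"
        using less.prems l' q by (intro less.IH step) auto
      then show ?thesis by (simp add: l' mult.assoc)
    qed
  qed
  obtain k' where k': "k' > 0" "[k' = k] (mod n)" "\<forall>q. prime q \<longrightarrow> q dvd k' \<longrightarrow> A < q"
    using lift_coprime_large_primes[OF k z(2)] by blast
  have "?e F (z ^ (1 * k')) = 0"
    using root k' by (intro prod) auto
  then show ?thesis using k'(2) zmod[of k] zmod[of k'] by (simp add: cong_def)
qed

section \<open>Additive characters of the integers modulo n\<close>

definition chi :: "int \<Rightarrow> int \<Rightarrow> complex" where
  "chi n a = cis (2 * pi * of_int a / of_int n)"

lemma chi_0 [simp]: "chi n 0 = 1"
  by (simp add: chi_def)

lemma chi_add: "chi n (a + b) = chi n a * chi n b"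
  by (simp add: chi_def cis_mult ring_distribs add_divide_distrib)

lemma norm_chi [simp]: "norm (chi n a) = 1"
  by (simp add: chi_def)

lemma chi_nonzero [simp]: "chi n a \<noteq> 0"
  using norm_chi[of n a] by (metis norm_zero zero_neq_one)

lemma chi_power: "chi n a ^ k = chi n (int k * a)"
  unfolding chi_def by (simp add: DeMoivre algebra_simps)

lemma chi_mult_cancel: "q \<noteq> 0 \<Longrightarrow> chi (q * n) (q * a) = chi n a"
  by (cases "n = 0") (simp_all add: chi_def field_simps)

lemma chi_eq_1_iff:
  assumes "n > 0"
  shows "chi n a = 1 \<longleftrightarrow> n dvd a"
proof
  assume "chi n a = 1"
  then have "cos (2 * pi * of_int a / of_int n) = 1"
    by (metis chi_def cis.simps(1) one_complex.simps(1))
  then obtain x :: int where "2 * pi * of_int a / of_int n = of_int x * 2 * pi"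
    using cos_one_2pi_int by blast
  then have "(of_int a :: real) = of_int (x * n)"
    using assms by (simp add: field_simps)
  then show "n dvd a" unfolding of_int_eq_iff by simp
next
  assume "n dvd a"
  then obtain k where a: "a = n * k" by auto
  have "chi n a = cis (2 * pi * of_int k)" 
    using assms unfolding chi_def a by (intro arg_cong[where f = cis]) (simp add: field_simps)
  then show "chi n a = 1" by (simp only: cis_multiple_2pi Ints_of_int)
qed

lemma chi_eq_iff:
  assumes "n > 0"
  shows "chi n a = chi n b \<longleftrightarrow> n dvd a - b"
proof -
  have "chi n a = chi n (a - b) * chi n b" by (simp flip: chi_add)
  then show ?thesis using chi_eq_1_iff[OF assms, of "a - b"] by simp
qed

lemma chi_mod [simp]: "n > 0 \<Longrightarrow> chi n (a mod n) = chi n a"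
  by (simp add: chi_eq_iff mod_eq_dvd_iff[symmetric])

lemma chi_mult_mod [simp]: "n > 0 \<Longrightarrow> chi n (j * (a mod n)) = chi n (j * a)"
  by (metis chi_mod mod_mult_right_eq)

lemma sum_int_interval: "(\<Sum>a\<in>{0..<n}. f a) = (\<Sum>j<nat n. f (int j))"
  for f :: "int \<Rightarrow> 'a :: comm_monoid_add"
  by (rule sum.reindex_bij_witness[where i = int and j = nat]) auto

lemma sum_chi:
  assumes "n > 0"
  shows "(\<Sum>i\<in>{0..<n}. chi n (i * d)) = (if n dvd d then of_int n else 0)"
proof (cases "n dvd d")
  case True
  then have "chi n (i * d) = 1" for i using chi_eq_1_iff[OF assms] by simp
  then show ?thesis using True assms by simp
next
  case False
  then have ne: "chi n d \<noteq> 1" using chi_eq_1_iff[OF assms] by simp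
  have "(\<Sum>i\<in>{0..<n}. chi n (i * d)) = (\<Sum>j<nat n. chi n d ^ j)"
    by (simp add: sum_int_interval chi_power)
  also have "\<dots> = (1 - chi n d ^ nat n) / (1 - chi n d)"
    using ne by (simp add: sum_gp_strict)
  also have "chi n d ^ nat n = 1"
    using assms by (simp add: chi_power chi_eq_1_iff)
  finally show ?thesis using False by simp
qed

lemma fourier_inversion:
  assumes "n > 0" "b \<in> {0..<n}"
  shows "(\<Sum>i\<in>{0..<n}. chi n (- (i * b)) * (\<Sum>a\<in>{0..<n}. f a * chi n (i * a))) = of_int n * f b"
proof -
  have "(\<Sum>i\<in>{0..<n}. chi n (- (i * b)) * (\<Sum>a\<in>{0..<n}. f a * chi n (i * a)))
      = (\<Sum>i\<in>{0..<n}. \<Sum>a\<in>{0..<n}. f a * chi n (i * (a - b)))"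
    by (simp add: sum_distrib_left ring_distribs chi_add[symmetric] mult.left_commute)
  also have "\<dots> = (\<Sum>a\<in>{0..<n}. f a * (\<Sum>i\<in>{0..<n}. chi n (i * (a - b))))"
    by (subst sum.swap) (simp add: sum_distrib_left)
  also have "\<dots> = (\<Sum>a\<in>{0..<n}. if a = b then f a * of_int n else 0)"
  proof (rule sum.cong)
    fix a assume a: "a \<in> {0..<n}"
    have "n dvd a - b \<longleftrightarrow> a = b"
      using a assms by (metis atLeastLessThan_iff mod_eq_dvd_iff mod_pos_pos_trivial)
    then show "f a * (\<Sum>i\<in>{0..<n}. chi n (i * (a - b))) = (if a = b then f a * of_int n else 0)"
      using sum_chi[OF assms(1)] by simp
  qed simp
  also have "\<dots> = of_int n * f b" using assms by simp
  finally show ?thesis .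
qed

text \<open>A function whose Fourier transform is supported at one frequency is a multiple of a character, hence
vanishes everywhere if it vanishes somewhere.\<close>

lemma single_frequency:
  assumes n: "n > 0"
    and freq: "\<And>i. i \<in> {0..<n} \<Longrightarrow> i \<noteq> i0 \<Longrightarrow> (\<Sum>a\<in>{0..<n}. f a * chi n (i * a)) = 0"
  shows "\<exists>C. \<forall>b\<in>{0..<n}. f b = C * chi n (- (i0 * b))"
proof -
  let ?g = "\<lambda>i. \<Sum>a\<in>{0..<n}. f a * chi n (i * a)"
  \<comment> \<open>The frequency \<open>i0\<close> need not lie in the chosen system of residues; then the whole transform is zero.\<close>
  define C where "C = (if i0 \<in> {0..<n} then ?g i0 else 0) / of_int n"
  have "f b = C * chi n (- (i0 * b))" if b: "b \<in> {0..<n}" for b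
  proof -
    have "of_int n * f b = (\<Sum>i\<in>{0..<n}. chi n (- (i * b)) * ?g i)"
      using fourier_inversion[OF n b, of f] by simp
    also have "\<dots> = (\<Sum>i\<in>{0..<n}. if i = i0 then chi n (- (i0 * b)) * ?g i0 else 0)"
      using freq by (intro sum.cong) auto
    also have "\<dots> = of_int n * (C * chi n (- (i0 * b)))"
      using n by (simp add: C_def)
    finally show ?thesis using n by simp
  qed
  then show ?thesis by blast
qed

lemma sum_residue_classes:
  fixes f :: "int \<Rightarrow> 'a :: comm_monoid_add"
  assumes "q > 0" "k > 0"
  shows "(\<Sum>a\<in>{0..<q * k}. f a) = (\<Sum>b\<in>{0..<q}. \<Sum>a\<in>{0..<k}. f (b + q * a))"
proof -
  have "(\<Sum>a\<in>{0..<q * k}. f a) = (\<Sum>(b, a)\<in>{0..<q} \<times> {0..<k}. f (b + q * a))"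
  proof (rule sum.reindex_bij_witness[where i = "\<lambda>(b, a). b + q * a" and j = "\<lambda>x. (x mod q, x div q)"])
    fix x assume x: "x \<in> {0..<q * k}"
    have "q * (x div q) \<le> x"
      using assms by (metis le_add_same_cancel1 mult_div_mod_eq pos_mod_sign)
    also have "x < q * k" using x by simp
    finally have "x div q < k" using assms by simp
    then show "(x mod q, x div q) \<in> {0..<q} \<times> {0..<k}"
      using x assms by (simp add: pos_imp_zdiv_nonneg_iff)
  next
    fix y assume "y \<in> {0..<q} \<times> {0..<k}"
    then obtain b a where y: "y = (b, a)" "0 \<le> b" "b < q" "0 \<le> a" "a < k" by auto
    have "b + q * a < q + q * a" using y by simp
    also have "\<dots> = q * (a + 1)" by (simp add: algebra_simps)
    also have "\<dots> \<le> q * k" using y assms by (intro mult_left_mono) auto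
    finally show "(case y of (b, a) \<Rightarrow> b + q * a) \<in> {0..<q * k}"
      using y assms by simp
  qed (use assms in \<open>auto simp: div_mult_self4\<close>)
  then show ?thesis by (simp add: sum.cartesian_product)
qed

section \<open>Vanishing sums of roots of unity\<close>

lemma galois_conjugate_sum:
  fixes c :: "int \<Rightarrow> int"
  assumes n: "n > 0" and zero: "(\<Sum>a\<in>{0..<n}. of_int (c a) * chi n a) = 0" and k: "coprime k n"
  shows "(\<Sum>a\<in>{0..<n}. of_int (c a) * chi n (k * a)) = 0"
proof -
  define F where "F = (\<Sum>j<nat n. Polynomial.monom (c (int j)) j)"
  have F: "poly (map_poly of_int F) z = (\<Sum>j<nat n. of_int (c (int j)) * z ^ j)" for z :: complex
    unfolding F_def by (simp add: hom_distribs poly_sum poly_monom)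
  define k' where "k' = nat (k mod n)"
  have k': "int k' = k mod n" using n by (simp add: k'_def)
  have cop: "coprime k' (nat n)"
    using k n k' by (metis coprime_int_iff coprime_mod_left_iff int_nat_eq less_imp_le less_irrefl)
  have "poly (map_poly of_int F) (chi n 1 ^ k') = 0"
  proof (rule galois_conjugate_root[OF _ _ _ cop])
    show "chi n 1 ^ nat n = 1" using n by (simp add: chi_power chi_eq_1_iff)
    show "poly (map_poly of_int F) (chi n 1) = 0"
      using zero unfolding F sum_int_interval by (simp add: chi_power)
  qed (use n in simp)
  then have "(\<Sum>j<nat n. of_int (c (int j)) * chi n (int j * (k mod n))) = 0"
    unfolding F by (simp add: chi_power k')
  then show ?thesis
    using n unfolding sum_int_interval by (simp add: mult.commute)
qed

text \<open>The Galois conjugation with exponent \<open>1 + k i\<close> multiplies the part of the sum in the class of \<open>b\<close>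
modulo \<open>q\<close> by \<open>chi q (i b)\<close>. Therefore the Fourier transform of \<open>f\<close> on \<open>Z\<^sub>q\<close> vanishes at every \<open>i\<close> for
which this exponent is prime to \<open>n\<close>. If \<open>q\<close> divides \<open>k\<close>, this is so for all \<open>i\<close>; otherwise it fails for
just one \<open>i\<close> modulo \<open>q\<close>, and one zero value of \<open>f\<close> makes up for it.\<close>

lemma class_sums_vanish:
  fixes c :: "int \<Rightarrow> int" and n q k :: int
  defines "f \<equiv> \<lambda>b. \<Sum>a\<in>{0..<k}. of_int (c (b + q * a)) * chi n (b + q * a)"
  assumes q: "prime q" and k: "k > 0" and n: "n = q * k"
    and zero: "(\<Sum>a\<in>{0..<n}. of_int (c a) * chi n a) = 0"
    and alt: "q dvd k \<or> (\<exists>b0\<in>{0..<q}. f b0 = 0)"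
    and b: "b \<in> {0..<q}"
  shows "f b = 0"
proof -
  have q0: "q > 0" using q prime_gt_0_int by blast
  have n0: "n > 0" using q0 k n by simp
  have g: "(\<Sum>b\<in>{0..<q}. f b * chi q (i * b)) = 0" if i: "\<not> q dvd 1 + k * i" for i
  proof -
    have "coprime (1 + k * i) k"
      by (rule coprimeI) (metis dvd_add_left_iff dvd_mult2)
    moreover have "coprime (1 + k * i) q"
      using q i by (simp add: coprime_commute prime_imp_coprime_int)
    ultimately have cop: "coprime (1 + k * i) n" unfolding n by simp
    have "(\<Sum>b\<in>{0..<q}. f b * chi q (i * b))
        = (\<Sum>b\<in>{0..<q}. \<Sum>a\<in>{0..<k}. of_int (c (b + q * a)) * chi n ((1 + k * i) * (b + q * a)))"
    proof (rule sum.cong)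
      fix b assume "b \<in> {0..<q}"
      have *: "chi n ((1 + k * i) * (b + q * a)) = chi n (b + q * a) * chi q (i * b)" for a
      proof -
        have "chi n ((1 + k * i) * (b + q * a)) = chi n (b + q * a) * chi (k * q) (k * (i * (b + q * a)))"
          by (simp add: n algebra_simps flip: chi_add)
        also have "chi (k * q) (k * (i * (b + q * a))) = chi q (i * (b + q * a))"
          using k by (simp add: chi_mult_cancel)
        also have "\<dots> = chi q (i * b)"
          using q0 by (simp add: chi_eq_iff algebra_simps)
        finally show ?thesis .
      qed
      show "f b * chi q (i * b) = (\<Sum>a\<in>{0..<k}. of_int (c (b + q * a)) * chi n ((1 + k * i) * (b + q * a)))"
        unfolding f_def * by (simp add: sum_distrib_right mult.assoc)
    qed simp
    also have "\<dots> = (\<Sum>a\<in>{0..<n}. of_int (c a) * chi n ((1 + k * i) * a))"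
      unfolding n using q0 k by (simp add: sum_residue_classes)
    also have "\<dots> = 0" by (rule galois_conjugate_sum[OF n0 zero cop])
    finally show ?thesis .
  qed
  show ?thesis
  proof (cases "q dvd k")
    case True
    then have "\<not> q dvd 1 + k * i" for i
      using q by (metis dvd_add_left_iff dvd_mult2 not_prime_unit)
    then have "of_int q * f b = 0"
      using g fourier_inversion[OF q0 b, of f] by simp
    then show ?thesis using q0 by simp
  next
    case False
    then obtain b0 where b0: "b0 \<in> {0..<q}" "f b0 = 0" using alt by blast
    obtain i0 where i0: "\<And>i. i \<in> {0..<q} \<Longrightarrow> i \<noteq> i0 \<Longrightarrow> \<not> q dvd 1 + k * i"
    proof (cases "\<exists>i0\<in>{0..<q}. q dvd 1 + k * i0")
      case True
      then obtain i0 where i0: "i0 \<in> {0..<q}" "q dvd 1 + k * i0" by blast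
      have "i = i0" if i: "i \<in> {0..<q}" "q dvd 1 + k * i" for i
      proof -
        have "q dvd (1 + k * i) - (1 + k * i0)" using i i0 by (intro dvd_diff)
        then have "q dvd k * (i - i0)" by (simp add: algebra_simps)
        then have "q dvd i - i0" using False q prime_dvd_mult_iff by blast
        then show ?thesis using i(1) i0(1)
          by (metis atLeastLessThan_iff mod_eq_dvd_iff mod_pos_pos_trivial)
      qed
      then show ?thesis using that by blast
    qed (use that in blast)
    obtain C where C: "\<And>b. b \<in> {0..<q} \<Longrightarrow> f b = C * chi q (- (i0 * b))"
      using single_frequency[OF q0, of i0 f] g i0 by blast
    have "C = 0" using C[OF b0(1)] b0(2) by simp
    then show ?thesis using C[OF b] by simp
  qed
qed

lemma periodic_add_multiple:
  fixes c :: "int \<Rightarrow> 'a"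
  assumes per: "\<And>a. c (a + n) = c a"
  shows "c (a + n * j) = c a"
proof (induction j rule: int_induct[where k = 0])
  case (step1 i)
  then show ?case using per[of "a + n * i"] by (simp add: algebra_simps)
next
  case (step2 i)
  then show ?case using per[of "a + n * (i - 1)"] by (simp add: algebra_simps)
qed simp

text \<open>The typical relations are the sums over cosets of the subgroup of order \<open>p\<close>, and the claim is that
a relation with few terms is a combination of these. While \<open>n\<close> is not \<open>p\<close> itself, the relation
splits into relations modulo \<open>n / q\<close> for a prime \<open>q\<close>, either because \<open>q = p\<close> and \<open>p\<^sup>2\<close> divides \<open>n\<close>, or
because there are fewer than \<open>q\<close> terms. For \<open>n = p\<close> all nontrivial conjugates of the sum vanish,
which makes \<open>c\<close> constant.\<close>

lemma vanishing_sum_periodic: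
  fixes c :: "int \<Rightarrow> int"
  assumes "n > 0" "prime p" "p dvd n"
    and "\<And>a. c (a + n) = c a"
    and "\<And>q. prime q \<Longrightarrow> q dvd n \<Longrightarrow> q \<noteq> p \<Longrightarrow> int (card {a\<in>{0..<n}. c a \<noteq> 0}) < q"
    and "(\<Sum>a\<in>{0..<n}. of_int (c a) * chi n a) = 0"
  shows "c (a + n div p) = c a"
  using assms(1,3-)
proof (induction "nat n" arbitrary: n c a rule: less_induct)
  case less
  note n0 = less.prems(1) and per = less.prems(3) and zero = less.prems(5)
  have p0: "p > 0" using assms(2) prime_gt_0_int by blast
  have permul: "c (a + n * j) = c a" for a j
    by (rule periodic_add_multiple) (rule per)
  obtain l where l: "n = p * l" using less.prems(2) by auto
  have l0: "l > 0" using n0 p0 l by (simp add: zero_less_mult_iff)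
  show ?case
  proof (cases "l = 1")
    case True
    then have n: "n = p" using l by simp
    have "(\<Sum>a\<in>{0..<n}. of_int (c a) * chi n (i * a)) = 0" if "i \<in> {0..<n}" "i \<noteq> 0" for i
    proof (rule galois_conjugate_sum[OF n0 zero])
      have "\<not> n dvd i" using that zdvd_not_zless by auto
      then show "coprime i n" using assms(2) n by (metis coprime_commute prime_imp_coprime)
    qed
    then obtain C where C: "\<And>b. b \<in> {0..<n} \<Longrightarrow> of_int (c b) = C * chi n (- (0 * b))"
      using single_frequency[OF n0, of 0 "\<lambda>a. of_int (c a)"] by blast
    have "c b = c 0" for b
    proof -
      have "c b = c (b mod n + n * (b div n))" by simp
      also have "\<dots> = c (b mod n)" by (rule permul)
      finally have "c b = c (b mod n)" .
      moreover have "(of_int (c (b mod n)) :: complex) = of_int (c 0)"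
        using C[of "b mod n"] C[of 0] n0 by simp
      ultimately show ?thesis by (simp only: of_int_eq_iff)
    qed
    then show ?thesis by metis
  next
    case False
    then obtain q where q: "prime q" "q dvd l"
      using prime_divisor_exists[of l] l0 False by auto
    have q0: "q > 0" using q(1) prime_gt_0_int by blast
    obtain l' where l': "l = q * l'" using q(2) by auto
    define k where "k = p * l'"
    have nk: "n = q * k" by (simp add: k_def l l')
    have k0: "k > 0" using n0 q0 nk by (simp add: zero_less_mult_iff)
    let ?supp = "\<lambda>(n::int) c. {a\<in>{0..<n}. c a \<noteq> (0::int)}"
    let ?f = "\<lambda>b. \<Sum>a\<in>{0..<k}. of_int (c (b + q * a)) * chi n (b + q * a)"
    have fin: "finite (?supp n c)" for n c
      by (rule finite_subset[of _ "{0..<n}"]) auto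
    have alt: "q dvd k \<or> (\<exists>b0\<in>{0..<q}. ?f b0 = 0)"
    proof (cases "q = p")
      case False
      have "card ((\<lambda>a. a mod q) ` ?supp n c) \<le> card (?supp n c)" by (rule card_image_le[OF fin])
      also have "\<dots> < nat q"
        using less.prems(4)[OF q(1) _ False] nk q0 by (simp add: zless_nat_eq_int_zless)
      finally have "\<not> {0..<q} \<subseteq> (\<lambda>a. a mod q) ` ?supp n c"
        using card_mono[OF finite_imageI[OF fin], of "{0..<q}" "\<lambda>a. a mod q" n c] by auto
      then obtain b0 where b0: "b0 \<in> {0..<q}" "b0 \<notin> (\<lambda>a. a mod q) ` ?supp n c" by blast
      have "c (b0 + q * a) = 0" if "a \<in> {0..<k}" for a
      proof (rule ccontr)
        assume nz: "c (b0 + q * a) \<noteq> 0"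
        have "b0 + q * a < q + q * a" using b0 by simp
        also have "\<dots> = q * (a + 1)" by (simp add: algebra_simps)
        also have "\<dots> \<le> n" unfolding nk using that q0 by (intro mult_left_mono) auto
        finally have "b0 + q * a \<in> ?supp n c" using nz b0 that q0 by simp
        moreover have "(b0 + q * a) mod q = b0" using b0 by simp
        ultimately show False using b0(2) by (metis (no_types, lifting) image_eqI)
      qed
      then show ?thesis using b0(1) by (auto intro!: bexI[of _ b0])
    qed (simp add: k_def)
    have fz: "?f b = 0" if "b \<in> {0..<q}" for b
      using class_sums_vanish[OF q(1) k0 nk zero alt that] .
    have IH: "c (b + q * (a + k div p)) = c (b + q * a)" if b: "b \<in> {0..<q}" for a b
    proof -
      let ?c = "\<lambda>a. c (b + q * a)"
      show ?thesis
      proof (rule less.hyps[where c = ?c and n = k])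
        show "nat k < nat n" using nk k0 prime_gt_1_int[OF q(1)] by simp
        show "?c (a + k) = ?c a" for a
          using per[of "b + q * a"] by (simp add: nk algebra_simps)
        have "inj_on (\<lambda>a. b + q * a) (?supp k ?c)" using q0 by (intro inj_onI) simp
        moreover have "(\<lambda>a. b + q * a) ` ?supp k ?c \<subseteq> ?supp n c"
        proof safe
          fix a assume a: "a \<in> {0..<k}"
          have "b + q * a < q + q * a" using b by simp
          also have "\<dots> = q * (a + 1)" by (simp add: algebra_simps)
          also have "\<dots> \<le> n" unfolding nk using a q0 by (intro mult_left_mono) auto
          finally show "b + q * a \<in> {0..<n}" using a b q0 by simp
        qed
        ultimately have "card (?supp k ?c) \<le> card (?supp n c)"
          by (rule card_inj_on_le[OF _ _ fin])
        then show "int (card (?supp k ?c)) < r" if "prime r" "r dvd k" "r \<noteq> p" for r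
          using less.prems(4)[of r] that nk by fastforce
        have "?f b = chi n b * (\<Sum>a\<in>{0..<k}. of_int (?c a) * chi k a)"
          unfolding nk chi_add sum_distrib_left
          using q0 by (intro sum.cong) (simp_all add: chi_mult_cancel)
        then show "(\<Sum>a\<in>{0..<k}. of_int (?c a) * chi k a) = 0"
          using fz[OF b] by simp
      qed (use k0 k_def in auto)
    qed
    have "n div p = q * (k div p)" using p0 by (simp add: l l' k_def)
    then have "c (a + n div p) = c (a mod q + q * (a div q + k div p))"
      by (simp add: ring_distribs)
    also have "\<dots> = c (a mod q + q * (a div q))" using q0 by (intro IH) simp
    also have "\<dots> = c a" by simp
    finally show ?thesis .
  qed
qed

section \<open>Character sums of multisets\<close>

definition char_sum :: "int \<Rightarrow> int multiset \<Rightarrow> int \<Rightarrow> complex" where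
  "char_sum n S j = (\<Sum>s\<in>#S. chi n (j * s))"

definition dilate :: "int \<Rightarrow> int \<Rightarrow> int multiset \<Rightarrow> int multiset" where
  "dilate n u S = image_mset (\<lambda>s. (u * s) mod n) S"

text \<open>For \<open>k\<close> dividing \<open>n\<close> this is the coset of \<open>a\<close> modulo the subgroup \<open>kZ\<^sub>n\<close>, represented in \<open>{0..<n}\<close>.\<close>

definition residue_coset :: "int \<Rightarrow> int \<Rightarrow> int \<Rightarrow> int set" where
  "residue_coset n k a = {x\<in>{0..<n}. x mod k = a mod k}"

text \<open>Dilating the multiset permutes its character sums: this turns an equality between arbitrary
eigenvalues into one between sums at frequency \<open>1\<close>.\<close>

lemma char_sum_dilate:
  assumes "n > 0"
  shows "char_sum n (dilate n u S) j = char_sum n S (j * u)"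
  unfolding char_sum_def dilate_def using assms
  by (simp add: multiset.map_comp o_def mult.assoc)

lemma size_dilate [simp]: "size (dilate n u S) = size S"
  by (simp add: dilate_def)

lemma set_mset_dilate: "n > 0 \<Longrightarrow> set_mset (dilate n u S) \<subseteq> {0..<n}"
  by (auto simp: dilate_def)

lemma char_sum_eq_sum_count:
  assumes "set_mset S \<subseteq> {0..<n}"
  shows "char_sum n S j = (\<Sum>a\<in>{0..<n}. of_nat (count S a) * chi n (j * a))"
  using assms
proof (induction S)
  case (add x S)
  have "(\<Sum>a\<in>{0..<n}. of_nat (count (add_mset x S) a) * chi n (j * a))
      = (\<Sum>a\<in>{0..<n}. (if a = x then chi n (j * a) else 0) + of_nat (count S a) * chi n (j * a))"
    by (intro sum.cong) (auto simp: ring_distribs)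
  also have "\<dots> = chi n (j * x) + (\<Sum>a\<in>{0..<n}. of_nat (count S a) * chi n (j * a))"
    using add.prems by (simp add: sum.distrib)
  finally show ?case using add by (simp add: char_sum_def)
qed (simp add: char_sum_def)

lemma mset_eq_if_subseteq_size:
  assumes "A \<subseteq># B" "size B \<le> size A"
  shows "A = B"
  using assms mset_subset_size[of A B] by (auto simp: subset_mset.le_less)

lemma residue_coset_eq_image:
  assumes "p > 0" "k > 0"
  shows "residue_coset (p * k) k a = (\<lambda>i. a mod k + k * i) ` {0..<p}"
proof (intro equalityI subsetI)
  fix x assume x: "x \<in> residue_coset (p * k) k a"
  have "x = a mod k + k * (x div k)"
    using x by (metis (mono_tags, lifting) mem_Collect_eq mod_mult_div_eq residue_coset_def)
  moreover have "k * (x div k) \<le> x"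
    using assms by (metis le_add_same_cancel1 mult_div_mod_eq pos_mod_sign)
  then have "k * (x div k) < k * p" using x by (simp add: residue_coset_def mult.commute)
  then have "x div k < p" using assms by simp
  moreover have "x div k \<ge> 0" using x assms by (simp add: residue_coset_def pos_imp_zdiv_nonneg_iff)
  ultimately show "x \<in> (\<lambda>i. a mod k + k * i) ` {0..<p}" by auto
next
  fix x assume "x \<in> (\<lambda>i. a mod k + k * i) ` {0..<p}"
  then obtain i where "i \<in> {0..<p}" and i: "x = a mod k + k * i" by blast
  then have i: "x = a mod k + k * i" "0 \<le> i" "i < p" by auto
  have "x < k + k * i" using i assms by simp
  also have "\<dots> = k * (i + 1)" by (simp add: algebra_simps)
  also have "\<dots> \<le> k * p" using i assms by (intro mult_left_mono) auto
  finally show "x \<in> residue_coset (p * k) k a"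
    using i assms by (simp add: residue_coset_def mult.commute)
qed

lemma inj_on_residue_coset: "k > 0 \<Longrightarrow> inj_on (\<lambda>i. a mod k + k * i) A" for k :: int
  by (intro inj_onI) simp

lemma finite_residue_coset [simp]: "finite (residue_coset n k a)"
  unfolding residue_coset_def by (rule finite_subset[of _ "{0..<n}"]) auto

lemma card_residue_coset:
  assumes "p > 0" "k > 0"
  shows "card (residue_coset (p * k) k a) = nat p"
  unfolding residue_coset_eq_image[OF assms]
  using assms by (subst card_image) (auto intro: inj_on_residue_coset)

text \<open>The sum over the coset factors into a character value and a full sum over \<open>Z\<^sub>p\<close>, to which
orthogonality applies.\<close>

lemma char_sum_residue_coset:
  assumes "p > 0" "k > 0"
  shows "char_sum (p * k) (mset_set (residue_coset (p * k) k a)) j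
       = (if p dvd j then of_int p * chi (p * k) (j * a) else 0)"
proof -
  have "char_sum (p * k) (mset_set (residue_coset (p * k) k a)) j
      = (\<Sum>x\<in>residue_coset (p * k) k a. chi (p * k) (j * x))"
    by (simp add: char_sum_def sum_unfold_sum_mset)
  also have "\<dots> = (\<Sum>i\<in>{0..<p}. chi (p * k) (j * (a mod k + k * i)))"
    unfolding residue_coset_eq_image[OF assms]
    using assms by (subst sum.reindex) (auto intro: inj_on_residue_coset)
  also have "\<dots> = (\<Sum>i\<in>{0..<p}. chi (p * k) (j * (a mod k)) * chi p (i * j))"
  proof (rule sum.cong)
    fix i
    have "chi (p * k) (j * (a mod k + k * i)) = chi (p * k) (j * (a mod k)) * chi (k * p) (k * (i * j))"
      by (simp add: algebra_simps flip: chi_add)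
    then show "chi (p * k) (j * (a mod k + k * i)) = chi (p * k) (j * (a mod k)) * chi p (i * j)"
      using assms by (simp add: chi_mult_cancel)
  qed simp
  also have "\<dots> = chi (p * k) (j * (a mod k)) * (if p dvd j then of_int p else 0)"
    by (simp add: sum_chi[OF assms(1)] flip: sum_distrib_left)
  also have "\<dots> = (if p dvd j then of_int p * chi (p * k) (j * a) else 0)"
  proof (cases "p dvd j")
    case True
    then obtain i where "j = p * i" by auto
    then show ?thesis using assms by (simp add: chi_mult_cancel mult.assoc)
  qed simp
  finally show ?thesis .
qed

lemma norm_char_sum_le: "norm (char_sum n S j) \<le> size S"
proof (induction S)
  case (add x S)
  have eq: "char_sum n (add_mset x S) j = chi n (j * x) + char_sum n S j"
    by (simp add: char_sum_def)
  have "norm (char_sum n (add_mset x S) j) \<le> norm (chi n (j * x)) + norm (char_sum n S j)"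
    unfolding eq by (rule norm_triangle_ineq)
  then show ?case using add by simp
qed (simp add: char_sum_def)

text \<open>The sum at frequency \<open>0\<close> is the size, and no sum exceeds the size in absolute value.\<close>

lemma size_le_if_char_sums_subset:
  assumes "range (char_sum n S) \<subseteq> range (char_sum n T)"
  shows "size S \<le> size T"
proof -
  have "char_sum n S 0 \<in> range (char_sum n T)" using assms by blast
  then obtain j where "char_sum n T j = char_sum n S 0" by force
  moreover have "char_sum n S 0 = of_nat (size S)" by (simp add: char_sum_def)
  ultimately have "norm (of_nat (size S) :: complex) \<le> size T"
    using norm_char_sum_le[of n T j] by simp
  then show ?thesis by simp
qed

lemma inj_on_dilation:
  fixes n u :: int
  assumes "coprime u n"
  shows "inj_on (\<lambda>t. (u * t) mod n) {0..<n}"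
proof (rule inj_onI)
  fix x y assume xy: "x \<in> {0..<n}" "y \<in> {0..<n}" "(u * x) mod n = (u * y) mod n"
  then have "n dvd u * (x - y)" by (simp add: mod_eq_dvd_iff algebra_simps)
  then have "n dvd x - y"
    using assms coprime_dvd_mult_right_iff[of n u] by (simp add: coprime_commute[of n u])
  then show "x = y" using xy by (metis atLeastLessThan_iff mod_eq_dvd_iff mod_pos_pos_trivial)
qed

section \<open>Multisets with equal character sums\<close>

text \<open>Where \<open>S\<close> exceeds \<open>T\<close>, periodicity forces \<open>S\<close> to contain a whole coset of \<open>p\<close> elements, and \<open>S\<close> has no
room for more.\<close>

lemma periodic_excess_imp_coset:
  assumes p: "p > 0" and k: "k > 0"
    and S: "set_mset S \<subseteq> {0..<p * k}" and size: "int (size S) \<le> p"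
    and per: "\<And>a. int (count S ((a + k) mod (p * k))) - int (count T ((a + k) mod (p * k)))
                 = int (count S (a mod (p * k))) - int (count T (a mod (p * k)))"
    and excess: "count T a < count S a"
  shows "S = mset_set (residue_coset (p * k) k a) \<and> int (size S) = p"
proof -
  let ?n = "p * k" and ?R = "residue_coset (p * k) k a"
  define c where "c = (\<lambda>a. int (count S (a mod ?n)) - int (count T (a mod ?n)))"
  have "a \<in># S" using excess by (metis gr_implies_not0 not_in_iff)
  then have a: "a \<in> {0..<?n}" using S by blast
  have "x \<in># S" if x: "x \<in> ?R" for x
  proof -
    have "k dvd x - a" using x by (simp add: residue_coset_def mod_eq_dvd_iff)
    then obtain i where i: "x = a + k * i" by (metis add.commute diff_add_cancel dvdE)
    have "c x = c a" unfolding i by (rule periodic_add_multiple) (simp add: c_def per)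
    also have "c a > 0" using excess a by (simp add: c_def)
    finally have "count T x < count S x" using x by (simp add: c_def residue_coset_def)
    then show ?thesis by (metis gr_implies_not0 not_in_iff)
  qed
  then have "mset_set ?R \<subseteq># mset_set (set_mset S)"
    by (intro subset_imp_msubset_mset_set) auto
  also have "\<dots> \<subseteq># S" by (rule mset_set_set_mset_msubset)
  finally have sub: "mset_set ?R \<subseteq># S" .
  have "size (mset_set ?R) = nat p" using card_residue_coset[OF p k] by simp
  moreover have "size S \<le> nat p" using size p by simp
  ultimately have "S = mset_set ?R" using mset_eq_if_subseteq_size[OF sub] by simp
  then show ?thesis using card_residue_coset[OF p k] p by simp
qed

text \<open>The difference of the two multiplicities is a relation with at most \<open>size S + size T\<close> terms. The
empty multiset is a possible choice of \<open>T\<close>, which gives the multisets with sum zero.\<close>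

lemma equal_char_sums_imp_coset:
  assumes p: "prime p" and k: "k > 0" and n: "n = p * k"
    and S: "set_mset S \<subseteq> {0..<n}" and T: "set_mset T \<subseteq> {0..<n}" and size: "int (size S) \<le> p"
    and large: "\<And>q. prime q \<Longrightarrow> q dvd n \<Longrightarrow> q \<noteq> p \<Longrightarrow> int (size S + size T) < q"
    and eq: "char_sum n S 1 = char_sum n T 1"
    and excess: "count T a < count S a"
  shows "S = mset_set (residue_coset n k a) \<and> int (size S) = p"
proof -
  have p0: "p > 0" using p prime_gt_0_int by blast
  have n0: "n > 0" using p0 k n by simp
  define c where "c = (\<lambda>a. int (count S (a mod n)) - int (count T (a mod n)))"
  have "{a\<in>{0..<n}. c a \<noteq> 0} \<subseteq> set_mset S \<union> set_mset T"
    by (auto simp: c_def) (metis not_in_iff)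
  then have "card {a\<in>{0..<n}. c a \<noteq> 0} \<le> card (set_mset S \<union> set_mset T)"
    by (intro card_mono) auto
  also have "\<dots> \<le> card (set_mset S) + card (set_mset T)" by (rule card_Un_le)
  also have "\<dots> \<le> size S + size T"
  proof -
    have "card (set_mset M) \<le> size M" for M :: "int multiset"
      using size_mset_mono[OF mset_set_set_mset_msubset[of M]] by simp
    then show ?thesis by (intro add_mono)
  qed
  finally have supp: "card {a\<in>{0..<n}. c a \<noteq> 0} \<le> size S + size T" .
  have "(\<Sum>a\<in>{0..<n}. of_int (c a) * chi n a) = char_sum n S 1 - char_sum n T 1"
    unfolding char_sum_eq_sum_count[OF S] char_sum_eq_sum_count[OF T] sum_subtractf[symmetric]
    by (intro sum.cong) (auto simp: c_def algebra_simps)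
  then have zero: "(\<Sum>a\<in>{0..<n}. of_int (c a) * chi n a) = 0" using eq by simp
  have "c (a + n div p) = c a" for a
  proof (rule vanishing_sum_periodic[OF n0 p _ _ _ zero])
    show "int (card {a\<in>{0..<n}. c a \<noteq> 0}) < q" if "prime q" "q dvd n" "q \<noteq> p" for q
      using large[OF that] supp by linarith
  qed (simp_all add: n c_def)
  then have "c (a + k) = c a" for a using p0 n by simp
  then show ?thesis
    unfolding n c_def using p0 k S T size excess
    by (intro periodic_excess_imp_coset[where T = T]) (auto simp: n)
qed

lemma excess_exists:
  assumes "S \<noteq> T" "size S = size T"
  shows "\<exists>a. count T a < count S a"
proof (rule ccontr)
  assume "\<not> ?thesis"
  then have "S \<subseteq># T" by (simp add: subseteq_mset_def not_less)
  then show False using mset_eq_if_subseteq_size assms by fastforce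
qed

text \<open>For unit complex numbers \<open>u\<close> and \<open>v\<close> the conjugate of \<open>u + v\<close> is \<open>(u + v) / (u v)\<close>. A nonzero sum
therefore determines the product, and with it the pair.\<close>

lemma unit_pair_sums:
  fixes u v w z :: complex
  assumes "norm u = 1" "norm v = 1" "norm w = 1" "norm z = 1" "u + v = w + z" "u + v \<noteq> 0"
  shows "u = w \<and> v = z \<or> u = z \<and> v = w"
proof -
  have inv: "cnj x * x = 1" if "norm x = 1" for x
    using that by (simp add: complex_norm_square[symmetric] mult.commute)
  have 1: "cnj (u + v) * (u * v) = u + v"
  proof -
    have "cnj (u + v) * (u * v) = (cnj u * u) * v + (cnj v * v) * u"
      by (simp add: algebra_simps)
    then show ?thesis using inv[OF assms(1)] inv[OF assms(2)] by simp
  qed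
  have 2: "cnj (w + z) * (w * z) = w + z"
  proof -
    have "cnj (w + z) * (w * z) = (cnj w * w) * z + (cnj z * z) * w"
      by (simp add: algebra_simps)
    then show ?thesis using inv[OF assms(3)] inv[OF assms(4)] by simp
  qed
  have "cnj (u + v) * (u * v) = cnj (u + v) * (w * z)"
    using 1 2 assms(5) by simp
  then have "u * v = w * z" using assms(6) by (metis complex_cnj_zero_iff mult_cancel_left)
  then have "(u - w) * (u - z) = u * (u + v - (w + z))" by (simp add: algebra_simps)
  then have "u = w \<or> u = z" using assms(5) by simp
  then show ?thesis using assms(5) by auto
qed

lemma size_2_mset_cases:
  assumes "size M = 2"
  obtains a b where "M = {#a, b#}"
proof -
  obtain a N where M: "M = add_mset a N"
    using assms size_eq_Suc_imp_eq_union[of M 1] by auto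
  then have "size N = 1" using assms by simp
  then obtain b where "N = {#b#}" using size_1_singleton_mset by blast
  then show ?thesis using that M by simp
qed

text \<open>For \<open>m \<noteq> 2\<close> the bound on the primes \<open>q\<close> gives \<open>q > 2 m\<close>, so that the relation between \<open>S\<close> and \<open>T\<close> has fewer
than \<open>q\<close> terms. For \<open>m = 2\<close> it only gives \<open>q > 2\<close>, which does not suffice when \<open>q = 3\<close>; but two
distinct pairs of roots of unity have the same sum only if this sum is zero, and then \<open>S\<close> and \<open>T\<close> can
be treated separately, as relations with two terms.\<close>

lemma equal_char_sums_dichotomy:
  assumes p: "prime p" and k: "k > 0" and n: "n = p * k"
    and S: "set_mset S \<subseteq> {0..<n}" and T: "set_mset T \<subseteq> {0..<n}"
    and size: "size S = m" "size T = m" "int m \<le> p"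
    and large: "\<And>q. prime q \<Longrightarrow> q dvd n \<Longrightarrow> q \<noteq> p \<Longrightarrow> p < q \<and> p * (int m - 1) < q"
    and eq: "char_sum n S 1 = char_sum n T 1"
    and ne: "S \<noteq> T"
  shows "(\<exists>a. S = mset_set (residue_coset n k a)) \<and> (\<exists>b. T = mset_set (residue_coset n k b)) \<and> int m = p"
proof (cases "m = 2")
  case False
  have p2: "p \<ge> 2" using p prime_ge_2_int by blast
  have "int (2 * m) < q" if q: "prime q" "q dvd n" "q \<noteq> p" for q
  proof (cases "m \<le> 1")
    case True
    then show ?thesis using large[OF q] p2 by linarith
  next
    case False
    then have "p * 2 \<le> p * (int m - 1)" using \<open>m \<noteq> 2\<close> p2 by (intro mult_left_mono) auto
    then show ?thesis using large[OF q] size(3) by linarith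
  qed
  then have lg: "int (size S + size T) < q" "int (size T + size S) < q"
    if "prime q" "q dvd n" "q \<noteq> p" for q
    using that size by simp_all
  obtain a where a: "count T a < count S a" using excess_exists[OF ne] size by auto
  obtain b where b: "count S b < count T b" using excess_exists[OF ne[symmetric]] size by auto
  have szS: "int (size S) \<le> p" and szT: "int (size T) \<le> p" using size by simp_all
  have "S = mset_set (residue_coset n k a) \<and> int (size S) = p"
    by (rule equal_char_sums_imp_coset[OF p k n S T szS lg(1) eq a])
  moreover have "T = mset_set (residue_coset n k b) \<and> int (size T) = p"
    by (rule equal_char_sums_imp_coset[OF p k n T S szT lg(2) eq[symmetric] b])
  ultimately show ?thesis using size(1) by metis
next
  case True
  have n0: "n > 0" using p prime_gt_0_int n k by simp
  have p2: "p \<ge> 2" using p prime_ge_2_int by blast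
  obtain a b where ab: "S = {#a, b#}"
    using size(1) True by (auto elim: size_2_mset_cases)
  obtain c d where cd: "T = {#c, d#}"
    using size(2) True by (auto elim: size_2_mset_cases)
  have inj: "chi n x = chi n y \<longleftrightarrow> x = y" if "x \<in> {0..<n}" "y \<in> {0..<n}" for x y
    unfolding chi_eq_iff[OF n0] using that by (simp flip: mod_eq_dvd_iff)
  have sums: "chi n a + chi n b = chi n c + chi n d"
    using eq by (simp add: ab cd char_sum_def)
  have "chi n a + chi n b = 0"
  proof (rule ccontr)
    assume "chi n a + chi n b \<noteq> 0"
    then have "chi n a = chi n c \<and> chi n b = chi n d \<or> chi n a = chi n d \<and> chi n b = chi n c"
      using sums by (intro unit_pair_sums) auto
    then have "a = c \<and> b = d \<or> a = d \<and> b = c" using S T ab cd inj by auto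
    then show False using ne ab cd by (auto simp: add_mset_commute)
  qed
  then have zS: "char_sum n S 1 = char_sum n {#} 1" and zT: "char_sum n T 1 = char_sum n {#} 1"
    using sums by (simp_all add: ab cd char_sum_def)
  have lg: "int (size S + size {#}) < q" "int (size T + size {#}) < q"
    if q: "prime q" "q dvd n" "q \<noteq> p" for q
    using large[OF q] p2 size True by auto
  have szS: "int (size S) \<le> p" and szT: "int (size T) \<le> p" using size by simp_all
  have "count {#} a < count S a" "count {#} c < count T c" using ab cd by simp_all
  then have "S = mset_set (residue_coset n k a) \<and> int (size S) = p"
    and "T = mset_set (residue_coset n k c)"
    using equal_char_sums_imp_coset[OF p k n S _ szS lg(1) zS]
      equal_char_sums_imp_coset[OF p k n T _ szT lg(2) zT] by simp_all
  then show ?thesis using size(1) by metis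
qed

section \<open>Multisets with equal spectra\<close>

lemma sum_mset_eq_imp_eq:
  fixes f g :: "'a \<Rightarrow> int"
  assumes le: "\<And>x. x \<in># M \<Longrightarrow> f x \<le> g x" and eq: "(\<Sum>x\<in>#M. g x) \<le> (\<Sum>x\<in>#M. f x)" and x: "x \<in># M"
  shows "f x = g x"
proof -
  obtain M' where M: "M = add_mset x M'" using x by (meson multi_member_split)
  have "(\<Sum>x\<in>#M'. f x) \<le> (\<Sum>x\<in>#M'. g x)" using le M by (intro sum_mset_mono) auto
  then show ?thesis using eq le[OF x] M by simp
qed

text \<open>Multiplication by \<open>j\<close> or by \<open>l\<close> can only enlarge \<open>gcd t n\<close>. Going from \<open>T\<close> to \<open>S\<close> and back restores the sum
of these numbers, so none of them changes. Hence \<open>j\<close> is coprime to the order \<open>n / gcd t n\<close> of every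
element \<open>t\<close> of \<open>T\<close>. Only the class of \<open>j\<close> modulo these orders affects the dilation of \<open>T\<close>, and this
class contains a number prime to any given \<open>M\<close>. The modulus \<open>M\<close> is kept apart from \<open>n\<close> because for
cosets the lemma is applied to a proper divisor of the order of the group.\<close>

lemma mutual_dilations_imp_unit:
  fixes n M :: int
  assumes n: "n > 0" and M: "M > 0" and ST: "S = dilate n j T" and TS: "T = dilate n l S"
  shows "\<exists>u. coprime u M \<and> S = dilate n u T"
proof -
  let ?g = "\<lambda>U. \<Sum>t\<in>#U. gcd t n"
  have gcd_le: "gcd t n \<le> gcd (i * t) n" for i t
    using n by (intro zdvd_imp_le) auto
  have g_dilate: "?g (dilate n i U) = (\<Sum>t\<in>#U. gcd (i * t) n)" for i U
  proof -
    have gcd_mod: "gcd ((i * t) mod n) n = gcd (i * t) n" for t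
      by (rule trans[OF gcd.commute gcd_red_int[symmetric]])
    show ?thesis unfolding dilate_def multiset.map_comp o_def gcd_mod ..
  qed
  have "?g S \<le> ?g T"
    unfolding TS g_dilate by (intro sum_mset_mono gcd_le)
  then have "(\<Sum>t\<in>#T. gcd (j * t) n) \<le> ?g T" unfolding ST g_dilate .
  then have gcd_eq: "gcd t n = gcd (j * t) n" if "t \<in># T" for t
    using that by (intro sum_mset_eq_imp_eq[where M = T] gcd_le)
  have cop: "coprime j (n div gcd t n)" if t: "t \<in># T" for t
  proof -
    define d where "d = gcd t n"
    have d: "d > 0" using n by (simp add: d_def)
    obtain t' n' where tn: "t = d * t'" "n = d * n'"
      unfolding d_def by (meson dvdE gcd_dvd1 gcd_dvd2)
    have "j * t = d * (j * t')" by (subst tn(1)) (rule mult.left_commute)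
    then have "gcd (j * t) n = gcd (d * (j * t')) (d * n')"
      using tn(2) by (rule arg_cong2)
    also have "\<dots> = d * gcd (j * t') n'"
      using gcd_mult_distrib_int[of d "j * t'" n'] d by simp
    finally have "d * gcd (j * t') n' = d * 1"
      using gcd_eq[OF t] unfolding d_def by linarith
    then have "gcd (j * t') n' = 1" using d by (metis less_irrefl mult_cancel_left)
    then have "coprime (j * t') n'" by (simp only: coprime_iff_gcd_eq_1)
    then have cop': "coprime j n'" by (rule coprime_mult_left_iff[THEN iffD1, THEN conjunct1])
    have "n div gcd t n = d * n' div d" unfolding d_def[symmetric] by (rule arg_cong[OF tn(2)])
    also have "\<dots> = n'" using d by simp
    finally show ?thesis using cop' by metis
  qed
  \<comment> \<open>A common multiple of the orders of the elements of \<open>T\<close> that is still coprime to \<open>j\<close>.\<close>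
  define L where "L = (\<Prod>t\<in>set_mset T. n div gcd t n)"
  have "n div gcd t n > 0" for t
    using n by (simp add: pos_imp_zdiv_pos_iff zdvd_imp_le)
  then have L: "L > 0" unfolding L_def by (intro prod_pos) auto
  have "coprime j L" unfolding L_def using cop by (intro prod_coprime_right) auto
  then have "coprime (j mod L) L" using L by simp
  moreover have "int (nat (j mod L)) = j mod L" "int (nat L) = L" using L by simp_all
  ultimately have "coprime (nat (j mod L)) (nat L)" by (metis coprime_int_iff)
  moreover have "nat L > 0" using L by simp
  ultimately obtain v where v: "[v = nat (j mod L)] (mod (nat L))"
      "\<forall>q. prime q \<longrightarrow> q dvd v \<longrightarrow> nat M < q"
    using lift_coprime_large_primes[of "nat (j mod L)" "nat L" "nat M"] by blast
  have "coprime v (nat M)"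
  proof (rule ccontr)
    assume "\<not> coprime v (nat M)"
    then have "gcd v (nat M) \<noteq> 1" by (simp only: coprime_iff_gcd_eq_1) simp
    then obtain q where q: "prime q" "q dvd gcd v (nat M)" using prime_factor_nat by blast
    then have "q dvd v" "q dvd nat M" by simp_all
    then have "q \<le> nat M" "nat M < q" using M q(1) v(2) by (simp_all add: dvd_imp_le)
    then show False by simp
  qed
  then have "coprime (int v) (int (nat M))" by (simp only: coprime_int_iff)
  then have "coprime (int v) M" using M by simp
  moreover have "[int v = int (nat (j mod L))] (mod int (nat L))"
    using v(1) by (simp only: cong_int_iff)
  then have dvd: "L dvd int v - j" using L by (simp add: cong_def mod_eq_dvd_iff)
  have "(int v * t) mod n = (j * t) mod n" if t: "t \<in># T" for t
  proof -
    have "n div gcd t n dvd L" unfolding L_def using t by (intro dvd_prodI) auto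
    then have "(n div gcd t n) * gcd t n dvd (int v - j) * t"
      by (rule mult_dvd_mono[OF dvd_trans[OF _ dvd] gcd_dvd1])
    then show ?thesis by (simp add: mod_eq_dvd_iff algebra_simps)
  qed
  then have "S = dilate n (int v) T" unfolding ST dilate_def by (intro image_mset_cong) auto
  ultimately show ?thesis by blast
qed

text \<open>The dilation of a coset lies in a coset. It fills that coset if its elements are distinct, and they
are distinct because a further dilation has \<open>p\<close> distinct elements.\<close>

lemma coset_dilation_transfer:
  assumes p: "p > 0" and k: "k > 0"
    and S: "S = mset_set (residue_coset (p * k) k a)"
    and T: "T = dilate (p * k) l S"
    and jT: "dilate (p * k) j T = mset_set (residue_coset (p * k) k b)"
  shows "T = mset_set (residue_coset (p * k) k (l * a))"
proof -
  let ?n = "p * k"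
  have fin: "finite (residue_coset ?n k (l * a))" by simp
  have "(l * x) mod ?n \<in> residue_coset ?n k (l * a)" if "x \<in> residue_coset ?n k a" for x
  proof -
    have "x mod k = a mod k" using that by (simp add: residue_coset_def)
    then have "(l * x) mod k = (l * a) mod k" by (metis mod_mult_right_eq)
    then show ?thesis using p k by (simp add: residue_coset_def mod_mod_cancel)
  qed
  then have sub: "set_mset T \<subseteq> residue_coset ?n k (l * a)"
    unfolding T S by (auto simp: dilate_def)
  have "residue_coset ?n k b = (\<lambda>t. (j * t) mod ?n) ` set_mset T"
    using arg_cong[OF jT, of set_mset] by (simp add: dilate_def)
  then have "card (residue_coset ?n k b) \<le> card (set_mset T)" by (simp add: card_image_le)
  then have "set_mset T = residue_coset ?n k (l * a)"
    using sub card_residue_coset[OF p k] by (intro card_seteq) auto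
  moreover have "mset_set (set_mset T) = T"
  proof (rule mset_eq_if_subseteq_size[OF mset_set_set_mset_msubset])
    have "size T = size S" unfolding T by simp
    then show "size T \<le> size (mset_set (set_mset T))"
      using card_residue_coset[OF p k] calculation by (simp add: S)
  qed
  ultimately show ?thesis by simp
qed

text \<open>The nonzero eigenvalues of the coset of \<open>a\<close> are the numbers \<open>p chi k (i a)\<close>. Equality of the spectra
thus says that \<open>a\<close> and \<open>b\<close> are multiples of each other modulo \<open>k\<close>, which is the situation of
\<open>mutual_dilations_imp_unit\<close> for one-element multisets.\<close>

lemma cosets_same_spectrum_imp_unit:
  assumes p: "p > 0" and k: "k > 0"
    and S: "S = mset_set (residue_coset (p * k) k a)" and T: "T = mset_set (residue_coset (p * k) k b)"
    and spec: "range (char_sum (p * k) S) = range (char_sum (p * k) T)"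
  shows "\<exists>u. coprime u (p * k) \<and> S = dilate (p * k) u T"
proof -
  let ?n = "p * k" and ?R = "residue_coset (p * k) k"
  have n: "?n > 0" using p k by simp
  have mult: "\<exists>i. a mod k = (i * (b mod k)) mod k"
    if "range (char_sum ?n (mset_set (?R a))) \<subseteq> range (char_sum ?n (mset_set (?R b)))" for a b
  proof -
    have "char_sum ?n (mset_set (?R a)) p \<in> range (char_sum ?n (mset_set (?R b)))"
      using that by (rule subsetD) (rule rangeI)
    then obtain j where "char_sum ?n (mset_set (?R a)) p = char_sum ?n (mset_set (?R b)) j"
      by (rule rangeE)
    then have eq: "of_int p * chi ?n (p * a) = (if p dvd j then of_int p * chi ?n (j * b) else 0)"
      unfolding char_sum_residue_coset[OF p k] by simp
    then have "p dvd j" using p by (auto split: if_splits)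
    then obtain i where j: "j = p * i" by auto
    have "chi k a = chi k (i * b)" using eq p by (simp add: j chi_mult_cancel mult.assoc)
    then have "a mod k = (i * b) mod k" using chi_eq_iff[OF k] by (simp add: mod_eq_dvd_iff)
    then show ?thesis by (metis mod_mult_right_eq)
  qed
  obtain i where "a mod k = (i * (b mod k)) mod k"
    using mult[of a b] spec unfolding S T by auto
  moreover obtain l where "b mod k = (l * (a mod k)) mod k"
    using mult[of b a] spec unfolding S T by auto
  ultimately have "{#a mod k#} = dilate k i {#b mod k#}" "{#b mod k#} = dilate k l {#a mod k#}"
    by (simp_all add: dilate_def)
  then obtain u where u: "coprime u ?n" "{#a mod k#} = dilate k u {#b mod k#}"
    using mutual_dilations_imp_unit[OF k n] by blast
  let ?f = "\<lambda>t. (u * t) mod ?n"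
  have "?f ` ?R b \<subseteq> ?R a"
  proof safe
    fix x assume "x \<in> ?R b"
    then have "x mod k = b mod k" by (simp add: residue_coset_def)
    then have "(u * x) mod k = (u * (b mod k)) mod k" by (metis mod_mult_right_eq)
    also have "\<dots> = a mod k" using u(2) by (simp add: dilate_def)
    finally show "?f x \<in> ?R a" using p k by (simp add: residue_coset_def mod_mod_cancel)
  qed
  moreover have inj': "inj_on ?f (?R b)"
    by (rule inj_on_subset[OF inj_on_dilation[OF u(1)]]) (auto simp: residue_coset_def)
  ultimately have "?f ` ?R b = ?R a"
    using card_residue_coset[OF p k] by (intro card_seteq) (auto simp: card_image)
  then have "S = dilate ?n u T"
    unfolding S T dilate_def using inj' by (simp add: image_mset_mset_set)
  then show ?thesis using u(1) by blast
qed

theorem same_spectrum_imp_unit: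
  assumes p: "prime p" and n: "n > 0" "p dvd n"
    and S: "set_mset S \<subseteq> {0..<n}" and T: "set_mset T \<subseteq> {0..<n}"
    and size: "size S = m" "size T = m" "int m \<le> p"
    and large: "\<And>q. prime q \<Longrightarrow> q dvd n \<Longrightarrow> q \<noteq> p \<Longrightarrow> p < q \<and> p * (int m - 1) < q"
    and spec: "range (char_sum n S) = range (char_sum n T)"
  shows "\<exists>u. coprime u n \<and> S = dilate n u T"
proof -
  have p0: "p > 0" using p prime_gt_0_int by blast
  obtain k where k: "n = p * k" using n by auto
  have k0: "k > 0" using k n p0 by (simp add: zero_less_mult_iff)
  let ?coset = "\<lambda>U. \<exists>a. U = mset_set (residue_coset n k a)"
  have alt: "\<exists>j. U = dilate n j V \<or> (?coset U \<and> ?coset (dilate n j V))"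
    if U: "set_mset U \<subseteq> {0..<n}" "size U = m" and V: "size V = m"
      and r: "range (char_sum n U) \<subseteq> range (char_sum n V)" for U V
  proof -
    obtain j where "char_sum n U 1 = char_sum n V j" using r by blast
    then have "char_sum n U 1 = char_sum n (dilate n j V) 1"
      by (simp add: char_sum_dilate[OF n(1)])
    moreover have "size (dilate n j V) = m" using V by simp
    ultimately have "U \<noteq> dilate n j V \<Longrightarrow> ?coset U \<and> ?coset (dilate n j V)"
      using equal_char_sums_dichotomy[OF p k0 k U(1) set_mset_dilate[OF n(1), of j V] U(2) _ size(3) large]
      by auto
    then show ?thesis by auto
  qed
  obtain j where j: "S = dilate n j T \<or> (?coset S \<and> ?coset (dilate n j T))"
    using alt[OF S size(1) size(2)] spec by blast
  obtain l where l: "T = dilate n l S \<or> (?coset T \<and> ?coset (dilate n l S))"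
    using alt[OF T size(2) size(1)] spec by blast
  \<comment> \<open>The mixed case, in which one multiset is a coset and the other is a dilation of it.\<close>
  have transfer: "?coset V" if U: "?coset U" and V: "V = dilate n i U" and iV: "?coset (dilate n i' V)"
    for U V i i'
  proof -
    obtain a where "U = mset_set (residue_coset (p * k) k a)" using U unfolding k by auto
    moreover have "V = dilate (p * k) i U" using V unfolding k .
    moreover obtain b where "dilate (p * k) i' V = mset_set (residue_coset (p * k) k b)"
      using iV unfolding k by auto
    ultimately have "V = mset_set (residue_coset (p * k) k (i * a))"
      by (rule coset_dilation_transfer[OF p0 k0])
    then show ?thesis unfolding k by (rule exI)
  qed
  consider "S = dilate n j T" "T = dilate n l S" | "?coset S" "?coset T"
    using j l transfer[of S T l j] transfer[of T S j l] by argo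
  then show ?thesis
  proof cases
    case 1
    then show ?thesis by (rule mutual_dilations_imp_unit[OF n(1) n(1)])
  next
    case 2
    then obtain a b where "S = mset_set (residue_coset (p * k) k a)" "T = mset_set (residue_coset (p * k) k b)"
      unfolding k by auto
    then show ?thesis
      using spec unfolding k by (rule cosets_same_spectrum_imp_unit[OF p0 k0])
  qed
qed

section \<open>The spectrum of a circulant matrix\<close>

text \<open>The dual of \<open>circulant_mat_mult_vec\<close>: the inverse root \<open>w\<close> gives a left eigenvector for the same
eigenvalue.\<close>

lemma sum_power_mult_circulant:
  fixes z w :: "'a :: field"
  assumes z: "z ^ n = 1" and wz: "w * z = 1" and v: "v \<in> carrier_vec n"
  shows "(\<Sum>i<n. w ^ i * (circulant_mat n c *\<^sub>v v) $ i) = (\<Sum>d<n. c d * z ^ d) * (\<Sum>k<n. w ^ k * v $ k)"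
proof -
  have wn: "w ^ n = 1"
    using arg_cong[OF wz, of "\<lambda>x. x ^ n"] z by (simp add: power_mult_distrib)
  note wmod = power_mod_root_of_unity[OF wn]
  have entry: "w ^ ((k + n - d) mod n) = w ^ k * z ^ d" if "d < n" for d k
  proof -
    have "w ^ (n - d) = w ^ (n - d) * (w ^ d * z ^ d)"
      by (simp add: wz flip: power_mult_distrib)
    also have "\<dots> = w ^ (n - d + d) * z ^ d" by (simp only: power_add mult.assoc)
    also have "\<dots> = z ^ d" using that wn by simp
    finally have "w ^ (k + (n - d)) = w ^ k * z ^ d" by (simp add: power_add)
    then show ?thesis using that wmod by simp
  qed
  \<comment> \<open>The reflection \<open>d \<mapsto> k - d\<close> modulo \<open>n\<close> is an involution, used to reindex the columns.\<close>
  have refl: "(k + n - (k + n - d) mod n) mod n = d" if "k < n" "d < n" for k d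
  proof (cases "d \<le> k")
    case True
    then have "(k + n - d) mod n = k - d" using that by (simp add: mod_if)
    then show ?thesis using True that by (simp add: mod_if)
  next
    case False
    then have "(k + n - d) mod n = k + n - d" using that by simp
    then show ?thesis using False that by simp
  qed
  have column: "(\<Sum>i<n. w ^ i * c ((k + n - i) mod n)) = w ^ k * (\<Sum>d<n. c d * z ^ d)"
    if k: "k < n" for k
  proof -
    have "(\<Sum>i<n. w ^ i * c ((k + n - i) mod n)) = (\<Sum>d<n. w ^ ((k + n - d) mod n) * c d)"
      by (rule sum.reindex_bij_witness[where i = "\<lambda>d. (k + n - d) mod n" and j = "\<lambda>d. (k + n - d) mod n"])
        (use k in \<open>auto simp: refl intro: mod_less_divisor\<close>)
    also have "\<dots> = (\<Sum>d<n. w ^ k * (c d * z ^ d))"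
      by (intro sum.cong refl) (auto simp: entry mult_ac)
    finally show ?thesis by (simp add: sum_distrib_left)
  qed
  have "(\<Sum>i<n. w ^ i * (circulant_mat n c *\<^sub>v v) $ i)
      = (\<Sum>i<n. \<Sum>k<n. (w ^ i * c ((k + n - i) mod n)) * v $ k)"
    using v by (intro sum.cong)
      (auto simp: circulant_mat_def scalar_prod_def atLeast0LessThan sum_distrib_left mult.assoc)
  also have "\<dots> = (\<Sum>k<n. (\<Sum>i<n. w ^ i * c ((k + n - i) mod n)) * v $ k)"
    by (subst sum.swap) (simp add: sum_distrib_right)
  also have "\<dots> = (\<Sum>k<n. (\<Sum>d<n. c d * z ^ d) * (w ^ k * v $ k))"
    by (intro sum.cong refl) (auto simp: column mult_ac)
  finally show ?thesis by (simp add: sum_distrib_left)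
qed

text \<open>If \<open>\<mu>\<close> differs from all the character sums, then an eigenvector for \<open>\<mu>\<close> is orthogonal to all left
eigenvectors. Its Fourier transform is then zero, and so is the vector.\<close>

lemma circulant_mat_eigenvalue_iff:
  fixes c :: "nat \<Rightarrow> complex"
  assumes n: "n > 0"
  shows "eigenvalue (circulant_mat n c) \<mu> \<longleftrightarrow> (\<exists>j. \<mu> = (\<Sum>d<n. c d * chi (int n) j ^ d))"
proof
  assume "\<exists>j. \<mu> = (\<Sum>d<n. c d * chi (int n) j ^ d)"
  then obtain j where j: "\<mu> = (\<Sum>d<n. c d * chi (int n) j ^ d)" by blast
  have "chi (int n) j ^ n = 1" using n by (simp add: chi_power chi_eq_1_iff)
  then show "eigenvalue (circulant_mat n c) \<mu>"
    unfolding j by (rule circulant_mat_eigenvalue[OF _ n])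
next
  assume "eigenvalue (circulant_mat n c) \<mu>"
  then obtain v where v: "v \<in> carrier_vec n" "v \<noteq> 0\<^sub>v n" "circulant_mat n c *\<^sub>v v = \<mu> \<cdot>\<^sub>v v"
    unfolding eigenvalue_def eigenvector_def by (auto simp: circulant_mat_def)
  show "\<exists>j. \<mu> = (\<Sum>d<n. c d * chi (int n) j ^ d)"
  proof (rule ccontr)
    assume ne: "\<not> ?thesis"
    have hat: "(\<Sum>k<n. chi (int n) (- j) ^ k * v $ k) = 0" for j
    proof -
      let ?w = "\<Sum>k<n. chi (int n) (- j) ^ k * v $ k"
      have z: "chi (int n) j ^ n = 1" using n by (simp add: chi_power chi_eq_1_iff)
      have wz: "chi (int n) (- j) * chi (int n) j = 1" by (simp flip: chi_add)
      have "(\<Sum>d<n. c d * chi (int n) j ^ d) * ?w = (\<Sum>i<n. chi (int n) (- j) ^ i * (\<mu> \<cdot>\<^sub>v v) $ i)"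
        using sum_power_mult_circulant[OF z wz v(1), of c] v(3) by simp
      also have "\<dots> = \<mu> * ?w"
        using v(1) unfolding sum_distrib_left by (intro sum.cong) auto
      finally show ?thesis using ne by auto
    qed
    have "v $ k = 0" if k: "k < n" for k
    proof -
      have zero: "(\<Sum>a\<in>{0..<int n}. v $ nat a * chi (int n) (i * a)) = 0" for i
      proof -
        have "(\<Sum>a\<in>{0..<int n}. v $ nat a * chi (int n) (i * a))
            = (\<Sum>k<n. chi (int n) (- (- i)) ^ k * v $ k)"
          unfolding sum_int_interval by (simp add: chi_power mult.commute)
        then show ?thesis unfolding hat .
      qed
      then have "of_int (int n) * v $ nat (int k) = 0"
        using fourier_inversion[of "int n" "int k" "\<lambda>a. v $ nat a"] k by simp
      then show ?thesis using n by simp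
    qed
    then have "v = 0\<^sub>v n" using v(1) by (intro eq_vecI) auto
    then show False using v(2) by simp
  qed
qed

section \<open>Adjacency matrices of circulant graphs\<close>

lemma sorted_list_of_set_int_interval: "sorted_list_of_set {0..<int n} = map int [0..<n]"
proof -
  have "sorted_list_of_set (set (map int [0..<n])) = map int [0..<n]"
    by (rule sorted_list_of_set.idem_if_sorted_distinct) (auto simp: sorted_map distinct_map sorted_wrt_iff_nth_less)
  moreover have "set (map int [0..<n]) = {0..<int n}"
    by (auto simp: image_int_atLeastLessThan)
  ultimately show ?thesis by simp
qed

lemma add_mod_eq_iff:
  assumes "i < n" "j < n" "s \<in> {0..<int n}"
  shows "(int i + s) mod int n = int j \<longleftrightarrow> s = int ((j + n - i) mod n)"
proof -
  have "int ((j + n - i) mod n) = (int j - int i) mod int n"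
  proof -
    have "int ((j + n - i) mod n) = (int j - int i + int n) mod int n"
      using assms by (simp add: zmod_int of_nat_diff algebra_simps)
    then show ?thesis by simp
  qed
  moreover have "(int i + s) mod int n = int j \<longleftrightarrow> int n dvd int i + s - int j"
    using assms by (simp flip: mod_eq_dvd_iff)
  moreover have "s = (int j - int i) mod int n \<longleftrightarrow> int n dvd s - (int j - int i)"
    using assms by (simp flip: mod_eq_dvd_iff)
  ultimately show ?thesis by (simp add: algebra_simps)
qed

lemma adjacency_matrix_circulant_multigraph:
  assumes n: "n > 0" and S: "set_mset S \<subseteq> {0..<int n}"
  shows "adjacency_matrix (circulant_multigraph n S) = circulant_mat n (\<lambda>d. of_nat (count S (int d)))"
proof -
  let ?G = "circulant_multigraph n S"
  have vs: "sorted_list_of_set (verts ?G) = map int [0..<n]"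
    using n by (simp add: cayley_multidigraph_def carrier_integer_mod_group sorted_list_of_set_int_interval)
  have "card {e \<in> arcs ?G. tail ?G e = int i \<and> head ?G e = int j} = count S (int ((j + n - i) mod n))"
    if ij: "i < n" "j < n" for i j
  proof -
    let ?s = "int ((j + n - i) mod n)"
    have "{e \<in> arcs ?G. tail ?G e = int i \<and> head ?G e = int j}
        = {(x, s, k). x = int i \<and> s \<in> {0..<int n} \<and> (int i + s) mod int n = int j \<and> k < count S s}"
    proof -
      have "k < count S s \<Longrightarrow> s \<in> {0..<int n}" for k s
        using S by (metis gr_implies_not0 not_in_iff subsetD)
      then show ?thesis
        using n ij by (fastforce simp: cayley_multidigraph_def carrier_integer_mod_group)
    qed
    also have "\<dots> = (\<lambda>k. (int i, ?s, k)) ` {..<count S ?s}"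
      using add_mod_eq_iff[OF ij] n by auto
    finally show ?thesis by (simp add: card_image inj_on_def)
  qed
  then show ?thesis
    unfolding adjacency_matrix_def Let_def vs circulant_mat_def by (intro eq_matI) auto
qed

lemma adjacency_matrix_circulant_graph:
  assumes n: "n > 0" and S: "S \<subseteq> {0..<int n}"
  shows "adjacency_matrix (circulant_graph n S) = circulant_mat n (\<lambda>d. of_nat (count (mset_set S) (int d)))"
proof -
  let ?G = "circulant_graph n S"
  have fin: "finite S" using S by (rule finite_subset) simp
  have vs: "sorted_list_of_set (verts ?G) = map int [0..<n]"
    using n by (simp add: cayley_digraph_def with_proj_def carrier_integer_mod_group sorted_list_of_set_int_interval)
  have "card {e \<in> arcs ?G. tail ?G e = int i \<and> head ?G e = int j} = count (mset_set S) (int ((j + n - i) mod n))"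
    if ij: "i < n" "j < n" for i j
  proof -
    let ?s = "int ((j + n - i) mod n)"
    have "{e \<in> arcs ?G. tail ?G e = int i \<and> head ?G e = int j}
        = {e. e = (int i, int j) \<and> (\<exists>s\<in>S. (int i + s) mod int n = int j)}"
      using n ij
      by (auto simp: cayley_digraph_def with_proj_def carrier_integer_mod_group) metis
    also have "(\<exists>s\<in>S. (int i + s) mod int n = int j) \<longleftrightarrow> ?s \<in> S"
      using add_mod_eq_iff[OF ij] S by blast
    finally have eq: "{e \<in> arcs ?G. tail ?G e = int i \<and> head ?G e = int j}
        = {e. e = (int i, int j) \<and> ?s \<in> S}" .
    show ?thesis unfolding eq using fin by (cases "?s \<in> S") auto
  qed
  then show ?thesis
    unfolding adjacency_matrix_def Let_def vs circulant_mat_def by (intro eq_matI) auto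
qed

lemma spectrum_of_circulant:
  assumes n: "n > 0" and S: "set_mset S \<subseteq> {0..<int n}"
    and A: "adjacency_matrix G = circulant_mat n (\<lambda>d. of_nat (count S (int d)))"
  shows "size (digraph_spectrum G) = n" "set_mset (digraph_spectrum G) = range (char_sum (int n) S)"
proof -
  let ?P = "char_poly (adjacency_matrix G)"
  have P: "degree ?P = n" "lead_coeff ?P = 1"
    using degree_monic_char_poly[of "adjacency_matrix G" n] by (simp_all add: A)
  then show "size (digraph_spectrum G) = n" by (simp add: digraph_spectrum_def size_proots_complex)
  have "?P \<noteq> 0" using P(2) by auto
  then have "x \<in># digraph_spectrum G \<longleftrightarrow> eigenvalue (adjacency_matrix G) x" for x
    unfolding digraph_spectrum_def
    by (subst eigenvalue_root_char_poly[where n = n]) (simp_all add: A)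
  moreover have "(\<Sum>d<n. of_nat (count S (int d)) * chi (int n) j ^ d) = char_sum (int n) S j" for j
    unfolding char_sum_eq_sum_count[OF S] sum_int_interval by (simp add: chi_power mult.commute)
  ultimately show "set_mset (digraph_spectrum G) = range (char_sum (int n) S)"
    unfolding A circulant_mat_eigenvalue_iff[OF n] by auto
qed

section \<open>Isomorphisms given by units\<close>

lemma dilation_bij:
  assumes n: "n > 0" and u: "coprime u (int n)"
  shows "bij_betw (\<lambda>t. (u * t) mod int n) {0..<int n} {0..<int n}"
proof -
  have "(\<lambda>t. (u * t) mod int n) ` {0..<int n} \<subseteq> {0..<int n}" using n by auto
  then show ?thesis
    using inj_on_dilation[OF u] by (simp add: bij_betw_def endo_inj_surj)
qed

lemma dilation_add: "(u * ((x + s) mod n)) mod n = ((u * x) mod n + (u * s) mod n) mod n" for n :: int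
  by (simp only: mod_mult_right_eq mod_add_eq distrib_left)

lemma circulant_multigraph_iso:
  assumes n: "n > 0" and u: "coprime u (int n)" and T: "set_mset T \<subseteq> {0..<int n}"
    and S: "S = dilate (int n) u T"
  shows "digraph_iso (circulant_multigraph n T) (circulant_multigraph n S)"
proof -
  let ?f = "\<lambda>t. (u * t) mod int n"
  let ?G = "circulant_multigraph n T" and ?H = "circulant_multigraph n S"
  let ?h = "\<lparr> iso_verts = ?f, iso_arcs = (\<lambda>(x, s, i). (?f x, ?f s, i :: nat)),
      iso_head = head ?H, iso_tail = tail ?H \<rparr>"
  have bij: "bij_betw ?f {0..<int n} {0..<int n}" by (rule dilation_bij[OF n u])
  have inj: "inj_on ?f {0..<int n}" using bij by (simp add: bij_betw_def)
  have img: "?f ` {0..<int n} = {0..<int n}" using bij by (simp add: bij_betw_def)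
  have inT: "s \<in> {0..<int n}" if "i < count T s" for s i
    using T that by (metis gr_implies_not0 not_in_iff subsetD)
  have "set_mset S \<subseteq> {0..<int n}"
    unfolding S by (rule set_mset_dilate) (use n in simp)
  then have inS: "s \<in> {0..<int n}" if "i < count S s" for s i
    using that by (metis gr_implies_not0 not_in_iff subsetD)
  have count: "count S (?f s) = count T s" if s: "s \<in> {0..<int n}" for s
  proof -
    have fibre: "{x. x \<in># T \<and> ?f s = ?f x} = {x. x \<in># T \<and> x = s}"
      using inj_onD[OF inj, of s] T s by auto
    have "count S (?f s) = (\<Sum>x | x \<in># T \<and> x = s. count T x)"
      unfolding S dilate_def count_image_mset' fibre ..
    also have "\<dots> = count T s"
    proof (cases "s \<in># T")
      case True
      then have "{x. x \<in># T \<and> x = s} = {s}" by auto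
      then show ?thesis by simp
    next
      case False
      then have "{x. x \<in># T \<and> x = s} = {}" by auto
      then show ?thesis using False by (simp add: not_in_iff)
    qed
    finally show ?thesis .
  qed
  have wf: "wf_digraph ?G"
    by unfold_locales (use n in \<open>auto simp: cayley_multidigraph_def carrier_integer_mod_group\<close>)
  have "pre_digraph.digraph_isomorphism ?G ?h"
    unfolding pre_digraph.digraph_isomorphism_def
  proof (intro conjI ballI wf)
    show "inj_on (iso_verts ?h) (verts ?G)"
      using inj n by (simp add: cayley_multidigraph_def carrier_integer_mod_group)
    show "inj_on (iso_arcs ?h) (arcs ?G)"
    proof (rule inj_onI)
      fix a b assume a: "a \<in> arcs ?G" and b: "b \<in> arcs ?G" and eq: "iso_arcs ?h a = iso_arcs ?h b"
      obtain x s i where x: "a = (x, s, i)" "x \<in> {0..<int n}" "i < count T s"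
        using a n by (auto simp: cayley_multidigraph_def carrier_integer_mod_group)
      obtain y t k where y: "b = (y, t, k)" "y \<in> {0..<int n}" "k < count T t"
        using b n by (auto simp: cayley_multidigraph_def carrier_integer_mod_group)
      have "?f x = ?f y" "?f s = ?f t" "i = k" using eq x(1) y(1) by simp_all
      then show "a = b"
        using inj_onD[OF inj _ x(2) y(2)] inj_onD[OF inj _ inT[OF x(3)] inT[OF y(3)]] x(1) y(1) by simp
    qed
    fix a assume "a \<in> arcs ?G"
    show "iso_verts ?h (tail ?G a) = iso_tail ?h (iso_arcs ?h a)"
      by (cases a) (simp add: cayley_multidigraph_def)
    show "iso_verts ?h (head ?G a) = iso_head ?h (iso_arcs ?h a)"
      by (cases a) (simp add: cayley_multidigraph_def mod_simps distrib_left)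
  qed
  moreover have "?H = app_iso ?h ?G"
  proof (rule pre_digraph.equality)
    show "verts ?H = verts (app_iso ?h ?G)"
      using img n by (simp add: cayley_multidigraph_def carrier_integer_mod_group)
    show "arcs ?H = arcs (app_iso ?h ?G)"
    proof (intro equalityI subsetI)
      fix e assume "e \<in> arcs ?H"
      then obtain x s i where e: "e = (x, s, i)" "x \<in> {0..<int n}" "i < count S s"
        using n by (auto simp: cayley_multidigraph_def carrier_integer_mod_group)
      obtain x' where x': "x' \<in> {0..<int n}" "x = ?f x'" using img e(2) by blast
      obtain s' where s': "s' \<in> {0..<int n}" "s = ?f s'" using img inS[OF e(3)] by blast
      have "(x', s', i) \<in> arcs ?G"
        using x' s' e(3) count n by (simp add: cayley_multidigraph_def carrier_integer_mod_group)
      then have "iso_arcs ?h (x', s', i) \<in> iso_arcs ?h ` arcs ?G" by (rule imageI)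
      then show "e \<in> arcs (app_iso ?h ?G)" by (simp add: e x' s')
    next
      fix e assume "e \<in> arcs (app_iso ?h ?G)"
      then obtain x s i where e: "e = (?f x, ?f s, i)" "x \<in> {0..<int n}" "i < count T s"
        using n by (auto simp: cayley_multidigraph_def carrier_integer_mod_group)
      then show "e \<in> arcs ?H"
        using count[OF inT[OF e(3)]] n by (simp add: cayley_multidigraph_def carrier_integer_mod_group)
    qed
  qed simp_all
  ultimately show ?thesis unfolding digraph_iso_def by blast
qed

lemma circulant_graph_iso:
  assumes n: "n > 0" and u: "coprime u (int n)" and T: "T \<subseteq> {0..<int n}"
    and S: "S = (\<lambda>t. (u * t) mod int n) ` T"
  shows "digraph_iso (circulant_graph n T) (circulant_graph n S)"
proof -
  let ?f = "\<lambda>t. (u * t) mod int n"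
  let ?G = "circulant_graph n T" and ?H = "circulant_graph n S"
  let ?h = "\<lparr> iso_verts = ?f, iso_arcs = map_prod ?f ?f, iso_head = snd, iso_tail = fst \<rparr>"
  have bij: "bij_betw ?f {0..<int n} {0..<int n}" by (rule dilation_bij[OF n u])
  have inj: "inj_on ?f {0..<int n}" using bij by (simp add: bij_betw_def)
  have img: "?f ` {0..<int n} = {0..<int n}" using bij by (simp add: bij_betw_def)
  have vG: "verts (circulant_graph n U) = {0..<int n}" for U
    using n by (simp add: cayley_digraph_def with_proj_def carrier_integer_mod_group)
  have aG: "arcs (circulant_graph n U) = (\<lambda>(x, s). (x, (x + s) mod int n)) ` ({0..<int n} \<times> U)" for U
    using n by (auto simp: cayley_digraph_def with_proj_def carrier_integer_mod_group)
  have th: "tail (circulant_graph n U) = fst" "head (circulant_graph n U) = snd" for U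
    by (simp_all add: cayley_digraph_def with_proj_def)
  have arcs_sub: "arcs ?G \<subseteq> {0..<int n} \<times> {0..<int n}" using n by (auto simp: aG)
  have wf: "wf_digraph ?G"
    by unfold_locales (use arcs_sub in \<open>auto simp: vG th\<close>)
  have "pre_digraph.digraph_isomorphism ?G ?h"
    unfolding pre_digraph.digraph_isomorphism_def
  proof (intro conjI ballI wf)
    show "inj_on (iso_verts ?h) (verts ?G)" using inj by (simp add: vG)
    have "inj_on (map_prod ?f ?f) (arcs ?G)"
      by (rule inj_on_subset[OF map_prod_inj_on[OF inj inj] arcs_sub])
    then show "inj_on (iso_arcs ?h) (arcs ?G)" by simp
  qed (simp_all add: th)
  moreover have "?H = app_iso ?h ?G"
  proof (rule pre_digraph.equality)
    show "verts ?H = verts (app_iso ?h ?G)" using img by (simp add: vG)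
    have "arcs (app_iso ?h ?G) = (\<lambda>(x, s). (?f x, ?f ((x + s) mod int n))) ` ({0..<int n} \<times> T)"
      by (simp add: aG image_image case_prod_unfold)
    also have "\<dots> = (\<lambda>(x, s). (x, (x + s) mod int n)) ` map_prod ?f ?f ` ({0..<int n} \<times> T)"
      by (simp only: image_image case_prod_unfold dilation_add fst_map_prod snd_map_prod)
    also have "map_prod ?f ?f ` ({0..<int n} \<times> T) = {0..<int n} \<times> S"
      unfolding S map_prod_surj_on[OF img refl] ..
    finally show "arcs ?H = arcs (app_iso ?h ?G)" by (simp add: aG)
  qed (simp_all add: th)
  ultimately show ?thesis unfolding digraph_iso_def by blast
qed

section \<open>Isospectral circulant graphs\<close>

lemma isospectral_imp_unit:
  assumes p: "prime p" and n: "n > 0" "p dvd n" "n' > 0"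
    and large: "\<And>q. prime q \<Longrightarrow> q dvd n \<Longrightarrow> q \<noteq> p \<Longrightarrow> int p < int q \<and> int p * (int m - 1) < int q"
    and m: "size S = m" "m \<le> p"
    and S: "set_mset S \<subseteq> {0..<int n}" and T: "set_mset T \<subseteq> {0..<int n'}"
    and G: "adjacency_matrix G = circulant_mat n (\<lambda>d. of_nat (count S (int d)))"
    and H: "adjacency_matrix H = circulant_mat n' (\<lambda>d. of_nat (count T (int d)))"
    and iso: "isospectral H G"
  shows "n' = n \<and> (\<exists>u. coprime u (int n) \<and> S = dilate (int n) u T)"
proof -
  note sG = spectrum_of_circulant[OF n(1) S G] and sH = spectrum_of_circulant[OF n(3) T H]
  have eq: "digraph_spectrum H = digraph_spectrum G" using iso by (simp add: isospectral_def)
  then have n': "n' = n" using sG(1) sH(1) by simp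
  have ranges: "range (char_sum (int n) S) = range (char_sum (int n) T)"
    using sG(2) sH(2) eq n' by simp
  have "size T = m"
    using size_le_if_char_sums_subset[of "int n" S T] size_le_if_char_sums_subset[of "int n" T S] ranges m(1)
    by simp
  moreover have "int p < q \<and> int p * (int m - 1) < q" if q: "prime q" "q dvd int n" "q \<noteq> int p" for q
  proof -
    obtain q' where q': "q = int q'" using q(1) prime_ge_0_int nonneg_int_cases by metis
    then show ?thesis using large[of q'] q by simp
  qed
  ultimately have "\<exists>u. coprime u (int n) \<and> S = dilate (int n) u T"
    using p n m S T n' by (intro same_spectrum_imp_unit[of "int p" "int n" S T m, OF _ _ _ _ _ _ _ _ _ ranges]) auto
  then show ?thesis using n' by simp
qed

theorem theorem1p1:
  fixes n s m :: nat and p r :: "nat \<Rightarrow> nat"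
  assumes "s \<ge> 1"
    and "\<forall>i\<in>{1..s}. prime (p i)"
    and "strict_mono_on {1..s} p"
    and "\<forall>i\<in>{1..s}. r i \<ge> 1"
    and "n = (\<Prod>i=1..s. p i ^ r i)"
    and "p 1 \<ge> m"
    and "s = 1 \<or> int (p 2) > int (p 1) * (int m - 1)"
  shows
    "(\<forall>S n' T.
        S \<subseteq> carrier (integer_mod_group n) - {0} \<and> card S = m \<and>
        n' > 0 \<and> T \<subseteq> carrier (integer_mod_group n') - {0} \<and>
        isospectral (circulant_graph n' T) (circulant_graph n S) \<longrightarrow>
        digraph_iso (circulant_graph n' T) (circulant_graph n S)) \<and>
     (\<forall>S n' T.
        set_mset S \<subseteq> carrier (integer_mod_group n) \<and> size S = m \<and>
        n' > 0 \<and> set_mset T \<subseteq> carrier (integer_mod_group n') \<and>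
        isospectral (circulant_multigraph n' T) (circulant_multigraph n S) \<longrightarrow>
        digraph_iso (circulant_multigraph n' T) (circulant_multigraph n S))"
proof -
  have n: "n > 0"
    unfolding assms(5) using assms(2) by (intro prod_pos) (simp add: prime_gt_0_nat)
  have p1: "prime (p 1)" using assms(1,2) by simp
  have "r 1 \<ge> 1" using assms(1,4) by simp
  then have "p 1 dvd p 1 ^ r 1" by (intro dvd_power) simp
  also have "p 1 ^ r 1 dvd n" unfolding assms(5) using assms(1) by (intro dvd_prodI) auto
  finally have p1n: "p 1 dvd n" .
  have large: "int (p 1) < int q \<and> int (p 1) * (int m - 1) < int q"
    if q: "prime q" "q dvd n" "q \<noteq> p 1" for q
  proof -
    obtain i where i: "i \<in> {1..s}" "q dvd p i ^ r i"
      using q(1,2) unfolding assms(5) by (auto simp: prime_dvd_prod_iff)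
    then have "q dvd p i" using q(1) prime_dvd_power by blast
    then have qi: "q = p i" using q(1) assms(2) i(1) primes_dvd_imp_eq by blast
    then have "i \<noteq> 1" using q(3) by metis
    then have i2: "2 \<le> i" "2 \<le> s" using i(1) by auto
    have "p 1 < p 2" using assms(3) i2 by (auto dest!: strict_mono_onD[where r = 1 and s = 2])
    moreover have "p 2 \<le> p i"
    proof (cases "i = 2")
      case False
      then have "p 2 < p i" using assms(3) i2 i(1) by (intro strict_mono_onD[OF assms(3)]) auto
      then show ?thesis by simp
    qed simp
    moreover have "int (p 1) * (int m - 1) < int (p 2)" using assms(7) i2 by auto
    ultimately show ?thesis unfolding qi by linarith
  qed
  have carrier: "carrier (integer_mod_group k) = {0..<int k}" if "k > 0" for k
    using that by (simp add: carrier_integer_mod_group)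
  show ?thesis
  proof (intro conjI allI impI; elim conjE)
    fix S n' T
    assume S: "S \<subseteq> carrier (integer_mod_group n) - {0}" "card S = m" and n': "n' > 0"
      and T: "T \<subseteq> carrier (integer_mod_group n') - {0}"
      and iso: "isospectral (circulant_graph n' T) (circulant_graph n S)"
    have S': "S \<subseteq> {0..<int n}" and T': "T \<subseteq> {0..<int n'}"
      using S(1) T carrier[OF n] carrier[OF n'] by auto
    have fin: "finite S" "finite T" using S' T' by (auto intro: finite_subset)
    have "n' = n \<and> (\<exists>u. coprime u (int n) \<and> mset_set S = dilate (int n) u (mset_set T))"
      using adjacency_matrix_circulant_graph[OF n S'] adjacency_matrix_circulant_graph[OF n' T']
      by (intro isospectral_imp_unit[OF p1 n p1n n' large _ assms(6) _ _ _ _ iso])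
        (use S' T' fin S(2) in auto)
    then obtain u where u: "n' = n" "coprime u (int n)" "mset_set S = dilate (int n) u (mset_set T)"
      by blast
    have "S = (\<lambda>t. (u * t) mod int n) ` T"
      using arg_cong[OF u(3), of set_mset] fin by (simp add: dilate_def)
    then show "digraph_iso (circulant_graph n' T) (circulant_graph n S)"
      using circulant_graph_iso[OF n u(2)] T' unfolding u(1) by blast
  next
    fix S n' T
    assume S: "set_mset S \<subseteq> carrier (integer_mod_group n)" "size S = m" and n': "n' > 0"
      and T: "set_mset T \<subseteq> carrier (integer_mod_group n')"
      and iso: "isospectral (circulant_multigraph n' T) (circulant_multigraph n S)"
    have S': "set_mset S \<subseteq> {0..<int n}" and T': "set_mset T \<subseteq> {0..<int n'}"
      using S(1) T carrier[OF n] carrier[OF n'] by auto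
    have "n' = n \<and> (\<exists>u. coprime u (int n) \<and> S = dilate (int n) u T)"
      by (rule isospectral_imp_unit[OF p1 n p1n n' large S(2) assms(6) S' T'
          adjacency_matrix_circulant_multigraph[OF n S'] adjacency_matrix_circulant_multigraph[OF n' T'] iso])
    then show "digraph_iso (circulant_multigraph n' T) (circulant_multigraph n S)"
      using circulant_multigraph_iso[OF n] T' by blast
  qed
qed

end
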